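(* Let $\alpha>0$, let $F_\alpha^2$ be the Fock space, let $L$ be a bounded linear operator on $F_\alpha^2$, and let $\{\lambda_n\}_{n=1}^{\infty}\subset \mathbb{C}$ be a sequence of distinct points. Put $k_{\lambda}^{\alpha}(z)=e^{\alpha(z\overline{\lambda}-\frac{|\lambda|^2}{2})}$ for $\lambda,z\in\mathbb{C}$. The following are equivalent: (i) $\{k_{\lambda_n}^{\alpha}\}_{n=1}^{\infty}$ is an atomic system for $L$, i.e. the series $\sum_{n=1}^{\infty} c_n e^{\alpha(z\overline{\lambda_n}-\frac{|\lambda_n|^2}{2})}$ converges in $F_{\alpha}^2$ for all $\{c_n\}\in l^2$, and there exists $C>0$ such that for every $f\in F_\alpha^2$ there exists $a_f=(a_n)\in l^2$ with $\|a_f\|_{l^2}\leq C\|f\|$ and $Lf(z)=\sum_{n=1}^{\infty} a_n e^{\alpha(z\overline{\lambda_n}-\frac{|\lambda_n|^2}{2})}$; (ii) $\{\lambda_n\}_{n=1}^{\infty}$ is a sampling sequence for $L$, i.e. there exist constants $A,B>0$ such that $$A\|L^*f\|^2\leq\sum_{n=1}^{\infty}|f(\lambda_n)|^2e^{-\alpha|\lambda_n|^2}\leq B\|f\|^2\quad\text{for all } f\in F_\alpha^2;$$ (iii) $\{k_{\lambda_n}^{\alpha}\}_{n=1}^{\infty}$ is a Bessel sequence and there exists a Bessel sequence $\{g_n\}_{n=1}^{\infty}\subset F_\alpha^2$ such that $$Lf(z)=\sum_{n=1}^{\infty}\langle f,g_n\rangle e^{\alpha(z\overline{\lambda_n}-\frac{|\lambda_n|^2}{2})}\quad\text{for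 all } f\in F_\alpha^2;$$ (iv) $\sum_{n=1}^{\infty}e^{-\alpha|\lambda_n|^2}|f(\lambda_n)|^2<\infty$ for all $f\in F_\alpha^2$, and there exists a Bessel sequence $\{g_n\}_{n=1}^{\infty}\subset F_\alpha^2$ such that $$L^*f=\sum_{n=1}^{\infty}e^{-\alpha\frac{|\lambda_n|^2}{2}}f(\lambda_n)g_n\quad\text{for all } f\in F_\alpha^2.$$
   Context: Let $dA$ be Lebesgue measure on $\mathbb{C}$ and, for $\alpha>0$, $dA_{\alpha}(z)=\frac{\alpha}{\pi}e^{-\alpha|z|^2}dA(z)$. The Fock space $F_{\alpha}^2$ is the Hilbert space of all entire functions $f$ on $\mathbb{C}$ with $\|f\|^2=\int_{\mathbb{C}}|f(z)|^2dA_\alpha(z)<\infty$, with inner product $\langle f,g\rangle=\int_{\mathbb{C}}f\overline{g}\,dA_\alpha$. It is a reproducing kernel Hilbert space with kernel $K_{\lambda}(z)=e^{\alpha z\overline{\lambda}}$, i.e. $f(\lambda)=\langle f,K_\lambda\rangle$, and $k_\lambda^\alpha=K_\lambda/\|K_\lambda\|$ is its normalized kernel. $L^*$ is the Hilbert space adjoint of $L$. Series of functions (including those written pointwise in $z$) converge in the norm of the space. A sequence $\{f_n\}_{n=1}^{\infty}$ in a Hilbert space $\mathcal{H}$ is a Bessel sequence if there is a constant $B>0$ such that $\sum_{n=1}^{\infty}|\langle x,f_n\rangle|^2\leq B\|x\|^2$ for all $x\in\mathcal{H}$. *)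

theory Defs
  imports "HOL-Complex_Analysis.Complex_Analysis"
begin

definition fock_measure :: "real \<Rightarrow> complex measure" where
  "fock_measure \<alpha> = density lborel (\<lambda>z. ennreal (\<alpha> / pi * exp (- \<alpha> * (cmod z)\<^sup>2)))"

text \<open>The parameter \<open>\<alpha>\<close> is an ordinary real variable, so the space is a carrier set of functions
  rather than a type; inner product and norm are meaningful on this carrier only.\<close>

definition fock_space :: "real \<Rightarrow> (complex \<Rightarrow> complex) set" where
  "fock_space \<alpha> =
    {f. f holomorphic_on UNIV \<and> integrable (fock_measure \<alpha>) (\<lambda>z. (cmod (f z))\<^sup>2)}"

definition fock_inner :: "real \<Rightarrow> (complex \<Rightarrow> complex) \<Rightarrow> (complex \<Rightarrow> complex) \<Rightarrow> complex" where
  "fock_inner \<alpha> f g = (LINT z|fock_measure \<alpha>. f z * cnj (g z))"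

definition fock_norm :: "real \<Rightarrow> (complex \<Rightarrow> complex) \<Rightarrow> real" where
  "fock_norm \<alpha> f = sqrt (LINT z|fock_measure \<alpha>. (cmod (f z))\<^sup>2)"

definition fock_normalized_kernel :: "real \<Rightarrow> complex \<Rightarrow> complex \<Rightarrow> complex" where
  "fock_normalized_kernel \<alpha> w z = exp (of_real \<alpha> * (z * cnj w - of_real ((cmod w)\<^sup>2 / 2)))"

definition fock_sums ::
    "real \<Rightarrow> (nat \<Rightarrow> complex \<Rightarrow> complex) \<Rightarrow> (complex \<Rightarrow> complex) \<Rightarrow> bool" where
  "fock_sums \<alpha> u s \<longleftrightarrow>
    (\<forall>n. u n \<in> fock_space \<alpha>) \<and> s \<in> fock_space \<alpha> \<and>
    (\<lambda>N. fock_norm \<alpha> (\<lambda>z. (\<Sum>n<N. u n z) - s z)) \<longlonglongrightarrow> 0"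

definition fock_bounded_operator ::
    "real \<Rightarrow> ((complex \<Rightarrow> complex) \<Rightarrow> (complex \<Rightarrow> complex)) \<Rightarrow> bool" where
  "fock_bounded_operator \<alpha> L \<longleftrightarrow>
    (\<forall>f\<in>fock_space \<alpha>. L f \<in> fock_space \<alpha>) \<and>
    (\<forall>f\<in>fock_space \<alpha>. \<forall>g\<in>fock_space \<alpha>. L (\<lambda>z. f z + g z) = (\<lambda>z. L f z + L g z)) \<and>
    (\<forall>c. \<forall>f\<in>fock_space \<alpha>. L (\<lambda>z. c * f z) = (\<lambda>z. c * L f z)) \<and>
    (\<exists>C. \<forall>f\<in>fock_space \<alpha>. fock_norm \<alpha> (L f) \<le> C * fock_norm \<alpha> f)"

text \<open>For a bounded operator \<open>L\<close> and \<open>g\<close> in the space, the described element exists and is unique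
  by the Riesz representation theorem.\<close>

definition fock_adjoint ::
    "real \<Rightarrow> ((complex \<Rightarrow> complex) \<Rightarrow> (complex \<Rightarrow> complex)) \<Rightarrow> (complex \<Rightarrow> complex) \<Rightarrow> (complex \<Rightarrow> complex)" where
  "fock_adjoint \<alpha> L g =
    (THE h. h \<in> fock_space \<alpha> \<and>
      (\<forall>f\<in>fock_space \<alpha>. fock_inner \<alpha> (L f) g = fock_inner \<alpha> f h))"

definition ell2 :: "(nat \<Rightarrow> complex) set" where
  "ell2 = {c. summable (\<lambda>n. (cmod (c n))\<^sup>2)}"

definition ell2_norm :: "(nat \<Rightarrow> complex) \<Rightarrow> real" where
  "ell2_norm c = sqrt (\<Sum>n. (cmod (c n))\<^sup>2)"

text \<open>Since \<open>suminf\<close> is unspecified on divergent series, convergence is stated explicitly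
  wherever an infinite sum is bounded from above.\<close>

definition fock_bessel :: "real \<Rightarrow> (nat \<Rightarrow> complex \<Rightarrow> complex) \<Rightarrow> bool" where
  "fock_bessel \<alpha> u \<longleftrightarrow>
    (\<forall>n. u n \<in> fock_space \<alpha>) \<and>
    (\<exists>B>0. \<forall>f\<in>fock_space \<alpha>.
      summable (\<lambda>n. (cmod (fock_inner \<alpha> f (u n)))\<^sup>2) \<and>
      (\<Sum>n. (cmod (fock_inner \<alpha> f (u n)))\<^sup>2) \<le> B * (fock_norm \<alpha> f)\<^sup>2)"

definition fock_atomic_system ::
    "real \<Rightarrow> ((complex \<Rightarrow> complex) \<Rightarrow> (complex \<Rightarrow> complex)) \<Rightarrow> (nat \<Rightarrow> complex \<Rightarrow> complex) \<Rightarrow> bool" where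
  "fock_atomic_system \<alpha> L u \<longleftrightarrow>
    (\<forall>c\<in>ell2. \<exists>s. fock_sums \<alpha> (\<lambda>n z. c n * u n z) s) \<and>
    (\<exists>C>0. \<forall>f\<in>fock_space \<alpha>. \<exists>a\<in>ell2.
      ell2_norm a \<le> C * fock_norm \<alpha> f \<and> fock_sums \<alpha> (\<lambda>n z. a n * u n z) (L f))"

definition fock_sampling_sequence ::
    "real \<Rightarrow> ((complex \<Rightarrow> complex) \<Rightarrow> (complex \<Rightarrow> complex)) \<Rightarrow> (nat \<Rightarrow> complex) \<Rightarrow> bool" where
  "fock_sampling_sequence \<alpha> L p \<longleftrightarrow>
    (\<exists>A>0. \<exists>B>0. \<forall>f\<in>fock_space \<alpha>.
      summable (\<lambda>n. (cmod (f (p n)))\<^sup>2 * exp (- \<alpha> * (cmod (p n))\<^sup>2)) \<and>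
      A * (fock_norm \<alpha> (fock_adjoint \<alpha> L f))\<^sup>2
        \<le> (\<Sum>n. (cmod (f (p n)))\<^sup>2 * exp (- \<alpha> * (cmod (p n))\<^sup>2)) \<and>
      (\<Sum>n. (cmod (f (p n)))\<^sup>2 * exp (- \<alpha> * (cmod (p n))\<^sup>2))
        \<le> B * (fock_norm \<alpha> f)\<^sup>2)"

end

theory Submission
  imports Defs "HOL-Library.Function_Algebras" "HOL-Probability.Distributions"
begin

text \<open>
Write \<open>k n\<close> for the normalised kernel at \<open>p n\<close>. The reproducing property says that
\<open>\<langle>f, k n\<rangle> = exp (- \<alpha> \<bar>p n\<bar>\<^sup>2 / 2) f (p n)\<close>, so sampling at the points \<open>p n\<close> is taking coefficients
against \<open>k\<close>, and every condition in the theorem becomes a statement about the sequence \<open>k\<close> in an abstract Hilbert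
space. In that form the equivalence holds for any sequence and any operator \<open>L\<close> with adjoint \<open>M\<close>
(\<open>atomic_system_characterizations\<close>). Let \<open>T f\<close> be the sequence of coefficients \<open>\<langle>f, k n\<rangle>\<close>.

Convergence of \<open>\<Sum> c n k n\<close> for all \<open>c \<in> \<ell>\<^sup>2\<close>, or square summability of \<open>T f\<close> for each \<open>f\<close>, forces \<open>k\<close> to be
a Bessel sequence; this rests on Landau's theorem and the uniform boundedness principle.
If \<open>L f = \<Sum> a n k n\<close> with \<open>\<parallel>a\<parallel> \<le> C \<parallel>f\<parallel>\<close>, then \<open>\<parallel>M f\<parallel>\<^sup>2 = \<langle>f, L (M f)\<rangle> \<le> C \<parallel>T f\<parallel> \<parallel>M f\<parallel>\<close>, which is the lower
sampling bound. Conversely a bound \<open>\<parallel>M f\<parallel> \<le> C \<parallel>T f\<parallel>\<close> yields a bounded linear choice of coefficients,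
hence a Bessel sequence \<open>g\<close> with \<open>L f = \<Sum> \<langle>f, g n\<rangle> k n\<close>
(\<open>bounded_by_bessel_coefficients_factors\<close>). The expansion of \<open>M\<close> along \<open>g\<close> is the adjoint of that of
\<open>L\<close> along \<open>k\<close> (\<open>dual_bessel_expansion\<close>).

It remains to know that the Fock space is a Hilbert space with the stated kernel. The Gaussian
measure is invariant under rotations, so an entire function that is integrable against it has its
value at \<open>0\<close> as mean. Applied to translates this is the reproducing property
(\<open>fock_reproducing\<close>), which bounds point evaluations locally uniformly and so gives
completeness (\<open>fock_hilbert_space\<close>).
\<close>

section \<open>Semi-inner product spaces\<close>

text \<open>Positive definiteness is left to a later locale: the argument below also needs the degenerate form
\<open>(f, g) \<mapsto> \<langle>T f, T g\<rangle>\<close> obtained by pulling the inner product of \<open>\<ell>\<^sup>2\<close> back along a map \<open>T\<close> that may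
have a kernel. The space is a carrier set, since a Fock space depends on a real parameter and
so cannot be a type.\<close>

locale semi_inner_space = vector_space scale
  for scale :: "complex \<Rightarrow> 'v::ab_group_add \<Rightarrow> 'v" (infixr "\<odot>" 75) +
  fixes V :: "'v set" and ip :: "'v \<Rightarrow> 'v \<Rightarrow> complex"
  assumes subspace_V: "subspace V"
    and ip_add_left: "\<lbrakk>x \<in> V; y \<in> V; z \<in> V\<rbrakk> \<Longrightarrow> ip (x + y) z = ip x z + ip y z"
    and ip_scale_left: "\<lbrakk>x \<in> V; z \<in> V\<rbrakk> \<Longrightarrow> ip (c \<odot> x) z = c * ip x z"
    and ip_commute: "\<lbrakk>x \<in> V; y \<in> V\<rbrakk> \<Longrightarrow> ip y x = cnj (ip x y)"
    and ip_nonneg: "x \<in> V \<Longrightarrow> 0 \<le> Re (ip x x)"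
begin

lemma zero_in [simp]: "0 \<in> V"
  and add_in [simp]: "x \<in> V \<Longrightarrow> y \<in> V \<Longrightarrow> x + y \<in> V"
  and scale_in [simp]: "x \<in> V \<Longrightarrow> c \<odot> x \<in> V"
  and diff_in [simp]: "x \<in> V \<Longrightarrow> y \<in> V \<Longrightarrow> x - y \<in> V"
  and sum_in: "(\<And>i. i \<in> I \<Longrightarrow> u i \<in> V) \<Longrightarrow> sum u I \<in> V"
  using subspace_V subspace_0 subspace_add subspace_scale subspace_diff subspace_sum by blast+

lemma ip_add_right: "\<lbrakk>x \<in> V; y \<in> V; z \<in> V\<rbrakk> \<Longrightarrow> ip z (x + y) = ip z x + ip z y"
  by (metis add_in complex_cnj_add ip_add_left ip_commute)

lemma ip_scale_right: "\<lbrakk>x \<in> V; z \<in> V\<rbrakk> \<Longrightarrow> ip z (c \<odot> x) = cnj c * ip z x"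
  by (metis scale_in complex_cnj_mult ip_scale_left ip_commute)

lemma ip_zero_left [simp]: "x \<in> V \<Longrightarrow> ip 0 x = 0"
  using ip_scale_left[of 0 x 0] by simp

lemma ip_diff_left: "\<lbrakk>x \<in> V; y \<in> V; z \<in> V\<rbrakk> \<Longrightarrow> ip (x - y) z = ip x z - ip y z"
  using ip_add_left[of "x - y" y z] by (simp add: algebra_simps)

lemma ip_diff_right: "\<lbrakk>x \<in> V; y \<in> V; z \<in> V\<rbrakk> \<Longrightarrow> ip z (x - y) = ip z x - ip z y"
  using ip_add_right[of "x - y" y z] by (simp add: algebra_simps)

lemma ip_sum_left:
  assumes "\<And>i. i \<in> I \<Longrightarrow> u i \<in> V" "y \<in> V"
  shows "ip (sum u I) y = (\<Sum>i\<in>I. ip (u i) y)"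
  using assms
proof (induction I rule: infinite_finite_induct)
  case (insert i I)
  then show ?case by (simp add: ip_add_left sum_in)
qed auto

definition nrm :: "'v \<Rightarrow> real" where "nrm x = sqrt (Re (ip x x))"

lemma nrm_nonneg [simp]: "x \<in> V \<Longrightarrow> 0 \<le> nrm x"
  by (simp add: nrm_def ip_nonneg)

lemma nrm_sq: "x \<in> V \<Longrightarrow> (nrm x)\<^sup>2 = Re (ip x x)"
  by (simp add: nrm_def ip_nonneg)

lemma ip_self: "x \<in> V \<Longrightarrow> ip x x = of_real ((nrm x)\<^sup>2)"
  using ip_commute[of x x] by (simp add: nrm_sq complex_eq_iff)

lemma nrm_zero [simp]: "nrm 0 = 0"
  by (simp add: nrm_def)

lemma nrm_add_sq:
  assumes "x \<in> V" "y \<in> V"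
  shows "(nrm (x + y))\<^sup>2 = (nrm x)\<^sup>2 + 2 * Re (ip x y) + (nrm y)\<^sup>2"
  using assms ip_commute[of x y] by (simp add: nrm_sq ip_add_left ip_add_right)

lemma nrm_scale: "x \<in> V \<Longrightarrow> nrm (c \<odot> x) = cmod c * nrm x"
proof -
  assume x: "x \<in> V"
  have "ip (c \<odot> x) (c \<odot> x) = (c * cnj c) * of_real ((nrm x)\<^sup>2)"
    using x by (simp add: ip_scale_left ip_scale_right ip_self[OF x] mult.assoc del: of_real_power)
  also have "\<dots> = of_real ((cmod c * nrm x)\<^sup>2)"
    by (simp only: complex_norm_square[symmetric] power_mult_distrib of_real_mult)
  finally have "(nrm (c \<odot> x))\<^sup>2 = (cmod c * nrm x)\<^sup>2"
    using x nrm_sq[of "c \<odot> x"] Re_complex_of_real by (metis scale_in)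
  then show ?thesis
    using x by (meson power2_eq_imp_eq nrm_nonneg norm_ge_zero mult_nonneg_nonneg scale_in)
qed

lemma nrm_minus_commute: "x \<in> V \<Longrightarrow> y \<in> V \<Longrightarrow> nrm (x - y) = nrm (y - x)"
  using nrm_scale[of "x - y" "-1"] by (simp add: scale_minus_left)

lemma nrm_add_scale_sq:
  assumes "x \<in> V" "y \<in> V"
  shows "(nrm (x + c \<odot> y))\<^sup>2 = (nrm x)\<^sup>2 + 2 * Re (cnj c * ip x y) + (cmod c)\<^sup>2 * (nrm y)\<^sup>2"
  using assms by (simp add: nrm_add_sq ip_scale_right nrm_scale power_mult_distrib)

lemma Cauchy_Schwarz:
  assumes x: "x \<in> V" and y: "y \<in> V"
  shows "cmod (ip x y) \<le> nrm x * nrm y"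
proof -
  let ?d = "ip x y"
  \<comment> \<open>The square of the norm of \<open>x - t \<langle>x, y\<rangle> y\<close> is nonnegative for every real \<open>t\<close>.\<close>
  have quad: "2 * t * (cmod ?d)\<^sup>2 \<le> (nrm x)\<^sup>2 + t\<^sup>2 * (cmod ?d)\<^sup>2 * (nrm y)\<^sup>2" for t :: real
  proof -
    have "0 \<le> (nrm (x + (- of_real t * ?d) \<odot> y))\<^sup>2" by simp
    also have "\<dots> = (nrm x)\<^sup>2 - 2 * t * (cmod ?d)\<^sup>2 + t\<^sup>2 * (cmod ?d)\<^sup>2 * (nrm y)\<^sup>2"
    proof -
      have "cnj (- of_real t * ?d) * ?d = of_real (- t * (cmod ?d)\<^sup>2)"
        unfolding of_real_mult complex_norm_square by (simp add: mult_ac)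
      then show ?thesis
        unfolding nrm_add_scale_sq[OF x y]
        by (metis (no_types, lifting) Re_complex_of_real diff_conv_add_uminus mult.assoc mult_minus_left mult_minus_right
            norm_minus_cancel norm_mult norm_of_real power2_abs power_mult_distrib)
    qed
    finally show ?thesis by simp
  qed
  have "(cmod ?d)\<^sup>2 \<le> (nrm x)\<^sup>2 * (nrm y)\<^sup>2"
  proof (cases "nrm y = 0")
    case True
    \<comment> \<open>Then the inequality is linear in \<open>t\<close>, and a large \<open>t\<close> contradicts it.\<close>
    have "(cmod ?d)\<^sup>2 = 0"
    proof (rule ccontr)
      assume *: "(cmod ?d)\<^sup>2 \<noteq> 0"
      have "2 * (((nrm x)\<^sup>2 + 1) / (cmod ?d)\<^sup>2) * (cmod ?d)\<^sup>2 \<le> (nrm x)\<^sup>2"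
        using quad[of "((nrm x)\<^sup>2 + 1) / (cmod ?d)\<^sup>2"] True by simp
      with * have "2 * ((nrm x)\<^sup>2 + 1) \<le> (nrm x)\<^sup>2" by simp
      moreover have "\<not> 2 * (t + 1) \<le> t" if "t \<ge> 0" for t :: real using that by auto
      ultimately show False using zero_le_power2[of "nrm x"] by blast
    qed
    then show ?thesis by (simp del: power_eq_0_iff zero_eq_power2)
  next
    case False
    then have "(nrm y)\<^sup>2 > 0" by simp
    moreover have "D \<le> a * b" if "b > 0" "2 * (1 / b) * D \<le> a + (1 / b)\<^sup>2 * D * b" for a b D :: real
    proof -
      have "(1 / b)\<^sup>2 * D * b = D / b" using that(1) by (simp add: power2_eq_square)
      then have "D / b \<le> a" using that(2) by simp
      then show ?thesis using that(1) by (simp add: pos_divide_le_eq)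
    qed
    ultimately show ?thesis using quad by blast
  qed
  then show ?thesis
    using x y by (metis power_mult_distrib power2_le_imp_le nrm_nonneg mult_nonneg_nonneg)
qed

lemma nrm_triangle:
  assumes "x \<in> V" "y \<in> V"
  shows "nrm (x + y) \<le> nrm x + nrm y"
proof (rule power2_le_imp_le)
  have "Re (ip x y) \<le> nrm x * nrm y"
    using Cauchy_Schwarz[OF assms] complex_Re_le_cmod order_trans by blast
  then show "(nrm (x + y))\<^sup>2 \<le> (nrm x + nrm y)\<^sup>2"
    by (simp add: nrm_add_sq assms power2_sum)
qed (use assms in simp)

lemma nrm_triangle_diff:
  assumes "x \<in> V" "y \<in> V" "z \<in> V"
  shows "nrm (x - z) \<le> nrm (x - y) + nrm (y - z)"
  using nrm_triangle[of "x - y" "y - z"] assms by simp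

lemma nrm_le_nrm_diff:
  assumes "x \<in> V" "y \<in> V"
  shows "\<bar>nrm x - nrm y\<bar> \<le> nrm (x - y)"
  using nrm_triangle[of "x - y" y] nrm_triangle[of "y - x" x] nrm_minus_commute[OF assms] assms by auto

lemma parallelogram:
  assumes "x \<in> V" "y \<in> V"
  shows "(nrm (x - y))\<^sup>2 + (nrm (x + y))\<^sup>2 = 2 * (nrm x)\<^sup>2 + 2 * (nrm y)\<^sup>2"
  using nrm_add_scale_sq[OF assms, of "-1"] nrm_add_sq[OF assms] by (simp add: scale_minus_left)

definition tends :: "(nat \<Rightarrow> 'v) \<Rightarrow> 'v \<Rightarrow> bool" where
  "tends X l \<longleftrightarrow> (\<lambda>n. nrm (X n - l)) \<longlonglongrightarrow> 0"

definition nrm_Cauchy :: "(nat \<Rightarrow> 'v) \<Rightarrow> bool" where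
  "nrm_Cauchy X \<longleftrightarrow> (\<forall>e>0. \<exists>N. \<forall>m\<ge>N. \<forall>n\<ge>N. nrm (X m - X n) < e)"

lemma tends_ip:
  assumes "tends X l" "\<And>n. X n \<in> V" "l \<in> V" "y \<in> V"
  shows "(\<lambda>n. ip (X n) y) \<longlonglongrightarrow> ip l y"
proof -
  have "(\<lambda>n. nrm (X n - l) * nrm y) \<longlonglongrightarrow> 0"
    using assms(1) unfolding tends_def by (rule tendsto_mult_left_zero)
  moreover have "cmod (ip (X n) y - ip l y) \<le> nrm (X n - l) * nrm y" for n
    using Cauchy_Schwarz[of "X n - l" y] assms by (simp add: ip_diff_left)
  ultimately have "(\<lambda>n. ip (X n) y - ip l y) \<longlonglongrightarrow> 0"
    by (rule_tac Lim_null_comparison) auto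
  then show ?thesis by (simp add: LIM_zero_iff)
qed

lemma tends_ip_right:
  assumes "tends X l" "\<And>n. X n \<in> V" "l \<in> V" "y \<in> V"
  shows "(\<lambda>n. ip y (X n)) \<longlonglongrightarrow> ip y l"
  using tendsto_cnj[OF tends_ip[OF assms]] assms by (simp add: ip_commute[symmetric])

lemma tends_nrm:
  assumes "tends X l" "\<And>n. X n \<in> V" "l \<in> V"
  shows "(\<lambda>n. nrm (X n)) \<longlonglongrightarrow> nrm l"
proof -
  have "(\<lambda>n. nrm (X n) - nrm l) \<longlonglongrightarrow> 0"
    by (rule Lim_null_comparison[OF _ assms(1)[unfolded tends_def]])
       (use nrm_le_nrm_diff assms in auto)
  then show ?thesis by (simp add: LIM_zero_iff)
qed

lemma tends_add:
  assumes "tends X l" "tends Y m" "\<And>n. X n \<in> V" "\<And>n. Y n \<in> V" "l \<in> V" "m \<in> V"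
  shows "tends (\<lambda>n. X n + Y n) (l + m)"
  unfolding tends_def
proof (rule Lim_null_comparison)
  show "(\<lambda>n. nrm (X n - l) + nrm (Y n - m)) \<longlonglongrightarrow> 0"
    using tendsto_add[OF assms(1,2)[unfolded tends_def]] by simp
  show "\<forall>\<^sub>F n in sequentially. norm (nrm (X n + Y n - (l + m))) \<le> nrm (X n - l) + nrm (Y n - m)"
    using nrm_triangle[of "X n - l" "Y n - m" for n] assms(3-) by (simp add: add_diff_add)
qed

lemma tends_scale:
  assumes "tends X l" "\<And>n. X n \<in> V" "l \<in> V"
  shows "tends (\<lambda>n. c \<odot> X n) (c \<odot> l)"
proof -
  have "nrm (c \<odot> X n - c \<odot> l) = cmod c * nrm (X n - l)" for n
    using nrm_scale[of "X n - l" c] assms by (simp add: scale_right_diff_distrib)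
  then show ?thesis
    using assms(1) unfolding tends_def by (simp add: tendsto_mult_right_zero)
qed

text \<open>The functional \<open>J x = \<parallel>x\<parallel>\<^sup>2 - 2 Re (\<phi> x)\<close> is bounded below. The parallelogram law makes every minimising
sequence Cauchy, and the first order condition at an approximate minimum says that \<open>\<langle>x, G j\<rangle>\<close> is
close to \<open>\<phi> x\<close>. In a complete space the limit of the sequence represents \<open>\<phi>\<close>; the sequence itself
is kept here because for a pulled back form the limit lives in another space.\<close>

lemma riesz_approximation:
  assumes add: "\<And>x y. x \<in> V \<Longrightarrow> y \<in> V \<Longrightarrow> \<phi> (x + y) = \<phi> x + \<phi> y"
    and scale: "\<And>c x. x \<in> V \<Longrightarrow> \<phi> (c \<odot> x) = c * \<phi> x"
    and bound: "\<And>x. x \<in> V \<Longrightarrow> cmod (\<phi> x) \<le> M * nrm x"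
  obtains G where "\<And>j. G j \<in> V" "nrm_Cauchy G"
    "\<And>x. x \<in> V \<Longrightarrow> (\<lambda>j. ip x (G j)) \<longlonglongrightarrow> \<phi> x"
proof -
  define J where "J x = (nrm x)\<^sup>2 - 2 * Re (\<phi> x)" for x
  have J_ge: "- M\<^sup>2 \<le> J x" if "x \<in> V" for x
  proof -
    have "Re (\<phi> x) \<le> M * nrm x"
      using bound[OF that] complex_Re_le_cmod order_trans by blast
    moreover have "2 * (M * nrm x) \<le> (nrm x)\<^sup>2 + M\<^sup>2"
      using sum_squares_bound[of "nrm x" M] by (simp add: mult_ac)
    ultimately show ?thesis unfolding J_def by linarith
  qed
  define m where "m = Inf (J ` V)"
  have bdd: "bdd_below (J ` V)"
    using J_ge by (meson bdd_belowI2)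
  have m_le: "m \<le> J x" if "x \<in> V" for x
    unfolding m_def using bdd that by (simp add: cINF_lower)
  have "\<exists>x\<in>V. J x < m + 1 / (real j + 1)" for j
    using cInf_lessD[of "J ` V" "m + 1 / (real j + 1)"] zero_in unfolding m_def by fastforce
  then obtain G where G: "\<And>j. G j \<in> V" "\<And>j. J (G j) < m + 1 / (real j + 1)"
    by metis
  have close: "(nrm (G i - G j))\<^sup>2 \<le> 2 / (real i + 1) + 2 / (real j + 1)" for i j
  proof -
    have mid: "J ((1/2) \<odot> (G i + G j)) = (nrm (G i + G j))\<^sup>2 / 4 - Re (\<phi> (G i) + \<phi> (G j))"
      using G(1) by (simp add: J_def nrm_scale scale add power_mult_distrib power2_eq_square add_divide_distrib)
    have "m \<le> J ((1/2) \<odot> (G i + G j))"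
      using G(1) by (intro m_le) simp
    with mid parallelogram[OF G(1) G(1), of i j] G(2)[of i] G(2)[of j]
    show ?thesis unfolding J_def by simp
  qed
  have "nrm_Cauchy G"
    unfolding nrm_Cauchy_def
  proof (intro allI impI)
    fix e :: real assume e: "e > 0"
    obtain N where N: "4 / e\<^sup>2 < real N" using reals_Archimedean2 by blast
    have "nrm (G i - G j) < e" if "i \<ge> N" "j \<ge> N" for i j
    proof -
      have N0: "4 / e\<^sup>2 < real N + 1" using N by simp
      have "2 / (real i + 1) + 2 / (real j + 1) \<le> 2 / (real N + 1) + 2 / (real N + 1)"
        using that by (intro add_mono divide_left_mono) auto
      also have "\<dots> = 4 / (real N + 1)" by simp
      also have "\<dots> < e\<^sup>2" using N0 e by (simp add: field_simps)
      finally have "(nrm (G i - G j))\<^sup>2 < e\<^sup>2" using close[of i j] by linarith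
      then show ?thesis using e by (meson less_imp_le power2_less_imp_less)
    qed
    then show "\<exists>N. \<forall>m\<ge>N. \<forall>n\<ge>N. nrm (G m - G n) < e" by blast
  qed
  moreover have "(\<lambda>j. ip x (G j)) \<longlonglongrightarrow> \<phi> x" if x: "x \<in> V" for x
  proof -
    have key: "(cmod (ip x (G j) - \<phi> x))\<^sup>2 \<le> ((nrm x)\<^sup>2 + 1) * (1 / (real j + 1))" for j
    proof -
      let ?d = "ip x (G j) - \<phi> x"
      \<comment> \<open>Moving from \<open>G j\<close> in the direction \<open>c x\<close> lowers \<open>J\<close> by at least \<open>s \<bar>d\<bar>\<^sup>2\<close>, where \<open>d\<close> is the defect;
        the choice of \<open>s\<close> makes the quadratic term at most half of the linear one.\<close>
      define s where "s = 1 / ((nrm x)\<^sup>2 + 1)"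
      define c where "c = - of_real s * cnj ?d"
      have pos: "(nrm x)\<^sup>2 + 1 > 0" by (rule add_nonneg_pos) auto
      then have s_pos: "s > 0" by (simp add: s_def)
      have re: "Re (cnj c * ip (G j) x) = Re (c * ip x (G j))"
        using ip_commute[OF x G(1)[of j]] by (metis cnj.simps(1) complex_cnj_cnj complex_cnj_mult)
      have "J (G j + c \<odot> x) = J (G j) + 2 * Re (c * ?d) + (cmod c)\<^sup>2 * (nrm x)\<^sup>2"
        unfolding J_def nrm_add_scale_sq[OF G(1) x] re
        using G(1) x by (simp add: add scale algebra_simps)
      moreover have "c * ?d = of_real (- s * (cmod ?d)\<^sup>2)"
        unfolding c_def using complex_norm_square[of ?d] by (simp add: mult_ac)
      moreover have "(cmod c)\<^sup>2 = s\<^sup>2 * (cmod ?d)\<^sup>2"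
        unfolding c_def norm_mult norm_minus_cancel norm_of_real complex_mod_cnj power_mult_distrib by simp
      moreover have "m \<le> J (G j + c \<odot> x)" using G(1) x by (intro m_le) simp
      ultimately have "2 * s * (cmod ?d)\<^sup>2 \<le> 1 / (real j + 1) + s\<^sup>2 * (cmod ?d)\<^sup>2 * (nrm x)\<^sup>2"
        using G(2)[of j] by simp
      moreover have "s\<^sup>2 * (cmod ?d)\<^sup>2 * (nrm x)\<^sup>2 \<le> s * (cmod ?d)\<^sup>2"
      proof -
        have "s * (nrm x)\<^sup>2 \<le> 1" using pos by (simp add: s_def)
        then have "s * (cmod ?d)\<^sup>2 * (s * (nrm x)\<^sup>2) \<le> s * (cmod ?d)\<^sup>2 * 1"
          using s_pos by (intro mult_left_mono) auto
        then show ?thesis by (simp add: power2_eq_square mult_ac)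
      qed
      ultimately have "s * (cmod ?d)\<^sup>2 \<le> 1 / (real j + 1)" by linarith
      then show ?thesis using pos by (simp add: s_def field_simps)
    qed
    have "(\<lambda>j. 1 / (real j + 1)) \<longlonglongrightarrow> 0"
      using LIMSEQ_Suc[OF lim_1_over_n[where 'a=real]] by (simp add: add.commute)
    then have "(\<lambda>j. ((nrm x)\<^sup>2 + 1) * (1 / (real j + 1))) \<longlonglongrightarrow> 0"
      by (rule tendsto_mult_right_zero)
    moreover have "\<forall>\<^sub>F j in sequentially. norm ((cmod (ip x (G j) - \<phi> x))\<^sup>2) \<le> ((nrm x)\<^sup>2 + 1) * (1 / (real j + 1))"
      using key by (simp del: times_divide_eq_right)
    ultimately have "(\<lambda>j. (cmod (ip x (G j) - \<phi> x))\<^sup>2) \<longlonglongrightarrow> 0"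
      by (rule Lim_null_comparison[rotated])
    from tendsto_real_sqrt[OF this] have "(\<lambda>j. cmod (ip x (G j) - \<phi> x)) \<longlonglongrightarrow> 0"
      by simp
    then show ?thesis
      by (simp add: LIM_zero_iff tendsto_norm_zero_iff)
  qed
  ultimately show thesis using G(1) that by blast
qed

end

section \<open>Hilbert spaces\<close>

locale hilbert_space = semi_inner_space scale V ip
  for scale :: "complex \<Rightarrow> 'v::ab_group_add \<Rightarrow> 'v" (infixr "\<odot>" 75) and V ip +
  assumes definite: "\<lbrakk>x \<in> V; ip x x = 0\<rbrakk> \<Longrightarrow> x = 0"
    and complete: "\<lbrakk>\<And>n. X n \<in> V; nrm_Cauchy X\<rbrakk> \<Longrightarrow> \<exists>l\<in>V. tends X l"
begin

lemma nrm_eq_0_iff: "x \<in> V \<Longrightarrow> nrm x = 0 \<longleftrightarrow> x = 0"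
  using definite[of x] ip_self[of x] by auto

lemma eq_if_ip_eq:
  assumes "x \<in> V" "y \<in> V" "\<And>z. z \<in> V \<Longrightarrow> ip z x = ip z y"
  shows "x = y"
  using definite[of "x - y"] assms by (simp add: ip_diff_right)

theorem riesz_representation:
  assumes add: "\<And>x y. x \<in> V \<Longrightarrow> y \<in> V \<Longrightarrow> \<phi> (x + y) = \<phi> x + \<phi> y"
    and scale: "\<And>c x. x \<in> V \<Longrightarrow> \<phi> (c \<odot> x) = c * \<phi> x"
    and bound: "\<And>x. x \<in> V \<Longrightarrow> cmod (\<phi> x) \<le> M * nrm x"
  obtains h where "h \<in> V" "\<And>x. x \<in> V \<Longrightarrow> \<phi> x = ip x h"
proof -
  obtain G where G: "\<And>j. G j \<in> V" "nrm_Cauchy G"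
    "\<And>x. x \<in> V \<Longrightarrow> (\<lambda>j. ip x (G j)) \<longlonglongrightarrow> \<phi> x"
    using riesz_approximation[OF assms] by metis
  obtain h where h: "h \<in> V" "tends G h" using complete[of G] G by blast
  have "\<phi> x = ip x h" if "x \<in> V" for x
    using tends_ip_right[OF h(2) G(1) h(1) that] G(3)[OF that] LIMSEQ_unique by blast
  then show thesis using h that by blast
qed

text \<open>The Banach-Steinhaus theorem for seminorms. The carrier is the union of the closed sets on which
all \<open>P n\<close> are at most \<open>K\<close>, so by Baire's theorem one of these sets contains a ball, and symmetry of
the ball around its centre transfers the bound to a ball around \<open>0\<close>.\<close>

theorem uniform_boundedness:
  fixes P :: "nat \<Rightarrow> 'v \<Rightarrow> real"
  assumes add: "\<And>n x y. x \<in> V \<Longrightarrow> y \<in> V \<Longrightarrow> P n (x + y) \<le> P n x + P n y"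
    and scale: "\<And>n c x. x \<in> V \<Longrightarrow> P n (c \<odot> x) = cmod c * P n x"
    and bound: "\<And>n x. x \<in> V \<Longrightarrow> P n x \<le> C n * nrm x"
    and pointwise: "\<And>x. x \<in> V \<Longrightarrow> \<exists>K. \<forall>n. P n x \<le> K"
  shows "\<exists>K. \<forall>n. \<forall>x\<in>V. P n x \<le> K * nrm x"
proof -
  \<comment> \<open>A metric must be nonnegative and symmetric off the carrier as well, hence the default value.\<close>
  define d where "d x y = (if x \<in> V \<and> y \<in> V then nrm (x - y) else 0)" for x y
  interpret M: Metric_space V d
  proof
    show "0 \<le> d x y" for x y by (simp add: d_def)
    show "d x y = d y x" for x y by (simp add: d_def nrm_minus_commute)
    show "d x y = 0 \<longleftrightarrow> x = y" if "x \<in> V" "y \<in> V" for x y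
      using that by (simp add: d_def nrm_eq_0_iff)
    show "d x z \<le> d x y + d y z" if "x \<in> V" "y \<in> V" "z \<in> V" for x y z
      using that by (simp add: d_def nrm_triangle_diff)
  qed
  have "M.mcomplete"
    unfolding M.mcomplete_def
  proof (intro allI impI)
    fix X assume X: "M.MCauchy X"
    then have in_V: "\<And>n. X n \<in> V" unfolding M.MCauchy_def by auto
    have "nrm_Cauchy X"
      using X in_V unfolding M.MCauchy_def nrm_Cauchy_def d_def by simp
    then obtain l where l: "l \<in> V" "tends X l" using complete in_V by blast
    then have "limitin M.mtopology X l sequentially"
      using in_V unfolding M.limitin_metric tends_def
      by (auto simp: d_def dest: order_tendstoD(2))
    then show "\<exists>l. limitin M.mtopology X l sequentially" ..
  qed
  define F where "F K = {x \<in> V. \<forall>n. P n x \<le> real K}" for K :: nat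
  have closed: "closedin M.mtopology (F K)" for K
    unfolding M.closedin_metric
  proof (intro conjI allI impI)
    show "F K \<subseteq> V" by (auto simp: F_def)
    fix x assume "x \<in> V - F K"
    then obtain n where x: "x \<in> V" and n: "P n x > real K" by (auto simp: F_def not_le)
    define r where "r = (P n x - K) / (\<bar>C n\<bar> + 1)"
    have "r > 0" using n by (simp add: r_def)
    moreover have "y \<notin> F K" if y: "y \<in> M.mball x r" for y
    proof
      assume "y \<in> F K"
      then have yF: "P n y \<le> K" "y \<in> V" by (auto simp: F_def)
      have "P n x \<le> P n y + P n (x - y)"
        using add[of y "x - y" n] x yF by simp
      also have "P n (x - y) \<le> C n * nrm (x - y)" using bound x yF by simp
      also have "\<dots> \<le> (\<bar>C n\<bar> + 1) * nrm (x - y)"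
        using x yF by (intro mult_right_mono) auto
      also have "\<dots> < (\<bar>C n\<bar> + 1) * r"
        using y x yF by (intro mult_strict_left_mono) (auto simp: d_def)
      also have "\<dots> = P n x - K" by (simp add: r_def)
      finally show False using yF by simp
    qed
    ultimately show "\<exists>r>0. disjnt (F K) (M.mball x r)" by (auto simp: disjnt_iff)
  qed
  have "\<Union>(range F) = V"
  proof -
    have "\<exists>K. x \<in> F K" if x: "x \<in> V" for x
    proof -
      obtain K where K: "\<forall>n. P n x \<le> K" using pointwise[OF x] by blast
      obtain k :: nat where "K \<le> k" using real_arch_simple by blast
      with K x show ?thesis unfolding F_def by (auto intro: order_trans)
    qed
    then show ?thesis by (auto simp: F_def)
  qed
  then have "M.mtopology interior_of \<Union>(range F) = V"
    using interior_of_topspace[of M.mtopology] by simp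
  then have "M.mtopology interior_of \<Union>(range F) \<noteq> {}"
    using zero_in by blast
  then obtain K where "M.mtopology interior_of F K \<noteq> {}"
    using M.metric_Baire_category_alt[OF \<open>M.mcomplete\<close>, of "range F"] closed
    by (metis countableI_type countable_image rangeE)
  then obtain x0 r where x0: "x0 \<in> V" "r > 0" "M.mball x0 r \<subseteq> F K"
    using M.in_interior_of_mball by (metis equals0I M.topspace_mtopology interior_of_subset_topspace subsetD)
  have "P n y \<le> (2 * real K / r) * nrm y" if y: "y \<in> V" for n y
  proof (cases "nrm y = 0")
    case True
    then show ?thesis using bound[OF y, of n] by simp
  next
    case False
    then have pos: "nrm y > 0" using nrm_nonneg[OF y] by linarith
    define z where "z = of_real (r / 2 / nrm y) \<odot> y"
    have z: "z \<in> V" using y by (simp add: z_def)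
    have "nrm z = \<bar>r / 2 / nrm y\<bar> * nrm y"
      unfolding z_def by (simp only: nrm_scale[OF y] norm_of_real)
    then have nrm_z: "nrm z = r / 2" using pos x0(2) by simp
    have "x0 + z \<in> M.mball x0 r" "x0 - z \<in> M.mball x0 r"
      using z nrm_z x0(1,2) nrm_minus_commute[of x0 "x0 + z"] nrm_minus_commute[of x0 "x0 - z"]
        nrm_scale[of z "-1"]
      by (auto simp: d_def)
    then have bd: "P n (x0 + z) \<le> K" "P n (x0 - z) \<le> K"
      using x0(3) by (auto simp: F_def)
    \<comment> \<open>Writing \<open>z\<close> through \<open>x0 + z\<close> and \<open>x0 - z\<close> removes the centre \<open>x0\<close>.\<close>
    have "2 \<odot> z = (x0 + z) + (-1) \<odot> (x0 - z)"
      using scale_left_distrib[of 1 1 z] by (simp add: scale_minus_left)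
    then have "2 * P n z \<le> P n (x0 + z) + P n (x0 - z)"
      using add[of "x0 + z" "(-1) \<odot> (x0 - z)" n] scale[of z n 2] scale[of "x0 - z" n "-1"] x0(1) z
      by simp
    with bd have "P n z \<le> K" by simp
    moreover have "P n z = r / 2 / nrm y * P n y"
      unfolding z_def scale[OF y] norm_of_real using pos x0(2) by simp
    ultimately show ?thesis using pos x0(2) by (simp add: field_simps)
  qed
  then show ?thesis by blast
qed

section \<open>Bessel sequences\<close>

definition nrm_sums :: "(nat \<Rightarrow> 'v) \<Rightarrow> 'v \<Rightarrow> bool" where
  "nrm_sums u s \<longleftrightarrow> (\<forall>n. u n \<in> V) \<and> s \<in> V \<and> tends (\<lambda>N. \<Sum>n<N. u n) s"

definition bessel :: "(nat \<Rightarrow> 'v) \<Rightarrow> bool" where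
  "bessel u \<longleftrightarrow> (\<forall>n. u n \<in> V) \<and>
    (\<exists>B>0. \<forall>f\<in>V. summable (\<lambda>n. (cmod (ip f (u n)))\<^sup>2) \<and>
      (\<Sum>n. (cmod (ip f (u n)))\<^sup>2) \<le> B * (nrm f)\<^sup>2)"

lemma nrm_sums_ip:
  assumes "nrm_sums u s" "y \<in> V"
  shows "(\<lambda>n. ip (u n) y) sums ip s y"
  using tends_ip[of "\<lambda>N. \<Sum>n<N. u n" s y] assms
  by (simp add: nrm_sums_def sums_def sum_in ip_sum_left)

text \<open>Square summability of the coefficients of each single vector already gives a uniform bound, by
the uniform boundedness principle applied to the norms of the truncated coefficient sequences.\<close>

theorem bessel_if_square_summable:
  assumes u: "\<And>n. u n \<in> V"
    and summ: "\<And>f. f \<in> V \<Longrightarrow> summable (\<lambda>n. (cmod (ip f (u n)))\<^sup>2)"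
  shows "bessel u"
proof -
  define P where "P N f = L2_set (\<lambda>n. cmod (ip f (u n))) {..<N}" for N f
  have P_sq: "(P N f)\<^sup>2 = (\<Sum>n<N. (cmod (ip f (u n)))\<^sup>2)" for N f
    by (simp add: P_def L2_set_def sum_nonneg)
  have P_nonneg: "0 \<le> P N f" for N f by (simp add: P_def)
  have "\<exists>K. \<forall>n. \<forall>x\<in>V. P n x \<le> K * nrm x"
  proof (rule uniform_boundedness)
    show "P N (x + y) \<le> P N x + P N y" if "x \<in> V" "y \<in> V" for N x y
    proof -
      have "P N (x + y) \<le> L2_set (\<lambda>n. cmod (ip x (u n)) + cmod (ip y (u n))) {..<N}"
        unfolding P_def by (rule L2_set_mono) (auto simp: ip_add_left that u norm_triangle_ineq)
      also have "\<dots> \<le> P N x + P N y" unfolding P_def by (rule L2_set_triangle_ineq)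
      finally show ?thesis .
    qed
    show "P N (c \<odot> x) = cmod c * P N x" if "x \<in> V" for N c x
      by (simp add: P_def ip_scale_left that u norm_mult L2_set_right_distrib)
    show "P N x \<le> L2_set (\<lambda>n. nrm (u n)) {..<N} * nrm x" if "x \<in> V" for N x
    proof -
      have "P N x \<le> L2_set (\<lambda>n. nrm x * nrm (u n)) {..<N}"
        unfolding P_def by (rule L2_set_mono) (auto simp: Cauchy_Schwarz that u)
      also have "\<dots> = nrm x * L2_set (\<lambda>n. nrm (u n)) {..<N}"
        using that by (simp add: L2_set_right_distrib)
      finally show ?thesis by (simp add: mult.commute)
    qed
    show "\<exists>K. \<forall>N. P N x \<le> K" if "x \<in> V" for x
    proof (intro exI allI)
      fix N
      have "(P N x)\<^sup>2 \<le> (\<Sum>n. (cmod (ip x (u n)))\<^sup>2)"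
        unfolding P_sq by (rule sum_le_suminf) (use summ that in auto)
      then show "P N x \<le> sqrt (\<Sum>n. (cmod (ip x (u n)))\<^sup>2)"
        by (rule real_le_rsqrt)
    qed
  qed
  then obtain K where K: "\<And>N x. x \<in> V \<Longrightarrow> P N x \<le> K * nrm x" by blast
  have "(\<Sum>n. (cmod (ip f (u n)))\<^sup>2) \<le> (K\<^sup>2 + 1) * (nrm f)\<^sup>2" if f: "f \<in> V" for f
  proof (rule suminf_le_const[OF summ[OF f]])
    fix N
    have "(P N f)\<^sup>2 \<le> (K * nrm f)\<^sup>2"
      using K[OF f] P_nonneg by (intro power_mono) auto
    also have "\<dots> \<le> (K\<^sup>2 + 1) * (nrm f)\<^sup>2"
      by (simp add: power_mult_distrib distrib_right)
    finally show "(\<Sum>n<N. (cmod (ip f (u n)))\<^sup>2) \<le> (K\<^sup>2 + 1) * (nrm f)\<^sup>2"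
      by (simp add: P_sq)
  qed
  moreover have "K\<^sup>2 + 1 > 0" by (rule add_nonneg_pos) auto
  ultimately show ?thesis
    unfolding bessel_def using u summ by blast
qed

end

section \<open>The Hilbert space of square summable sequences\<close>

definition ell2_ip :: "(nat \<Rightarrow> complex) \<Rightarrow> (nat \<Rightarrow> complex) \<Rightarrow> complex" where
  "ell2_ip a b = (\<Sum>n. a n * cnj (b n))"

lemma ell2_iff: "c \<in> ell2 \<longleftrightarrow> summable (\<lambda>n. (cmod (c n))\<^sup>2)"
  by (simp add: ell2_def)

lemma cmod_add_squared_le: "(cmod (x + y))\<^sup>2 \<le> 2 * (cmod x)\<^sup>2 + 2 * (cmod y)\<^sup>2"
proof -
  have "(cmod (x + y))\<^sup>2 \<le> (cmod x + cmod y)\<^sup>2"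
    by (intro power_mono norm_triangle_ineq) auto
  also have "\<dots> \<le> 2 * (cmod x)\<^sup>2 + 2 * (cmod y)\<^sup>2"
    using sum_squares_bound[of "cmod x" "cmod y"] by (simp add: power2_sum)
  finally show ?thesis .
qed

lemma ell2_add: "a \<in> ell2 \<Longrightarrow> b \<in> ell2 \<Longrightarrow> (\<lambda>n. a n + b n) \<in> ell2"
proof -
  assume ab: "a \<in> ell2" "b \<in> ell2"
  have "(cmod (a n + b n))\<^sup>2 \<le> 2 * (cmod (a n))\<^sup>2 + 2 * (cmod (b n))\<^sup>2" for n
    by (rule cmod_add_squared_le)
  moreover have "summable (\<lambda>n. 2 * (cmod (a n))\<^sup>2 + 2 * (cmod (b n))\<^sup>2)"
    using ab by (intro summable_add summable_mult) (auto simp: ell2_iff)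
  ultimately show ?thesis
    unfolding ell2_iff by (rule_tac summable_comparison_test'[where N=0]) auto
qed

lemma ell2_scale: "a \<in> ell2 \<Longrightarrow> (\<lambda>n. c * a n) \<in> ell2"
  by (auto simp: ell2_iff norm_mult power_mult_distrib intro: summable_mult)

lemma ell2_mult_summable:
  assumes "a \<in> ell2" "b \<in> ell2"
  shows "summable (\<lambda>n. a n * cnj (b n))"
proof (rule summable_comparison_test'[where N=0])
  show "summable (\<lambda>n. (cmod (a n))\<^sup>2 + (cmod (b n))\<^sup>2)"
    using assms by (intro summable_add) (auto simp: ell2_iff)
  show "norm (a n * cnj (b n)) \<le> (cmod (a n))\<^sup>2 + (cmod (b n))\<^sup>2" for n
    using sum_squares_bound[of "cmod (a n)" "cmod (b n)"] 
      mult_nonneg_nonneg[OF norm_ge_zero[of "a n"] norm_ge_zero[of "b n"]]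
    unfolding norm_mult complex_mod_cnj by linarith
qed

lemma ell2_ip_sums:
  "a \<in> ell2 \<Longrightarrow> b \<in> ell2 \<Longrightarrow> (\<lambda>n. a n * cnj (b n)) sums ell2_ip a b"
  unfolding ell2_ip_def by (simp add: ell2_mult_summable summable_sums)

lemma ell2_ip_self: "Re (ell2_ip a a) = (\<Sum>n. (cmod (a n))\<^sup>2)" if "a \<in> ell2"
proof -
  have "(\<lambda>n. of_real ((cmod (a n))\<^sup>2)) sums ell2_ip a a"
    using ell2_ip_sums[OF that that] unfolding complex_norm_square .
  then have "(\<lambda>n. Re (of_real ((cmod (a n))\<^sup>2))) sums Re (ell2_ip a a)"
    by (rule sums_Re)
  then show ?thesis by (simp add: sums_iff)
qed

interpretation ell2: semi_inner_space "\<lambda>c (a :: nat \<Rightarrow> complex) n. c * a n" ell2 ell2_ip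
proof -
  interpret vs: vector_space "\<lambda>c (a :: nat \<Rightarrow> complex) n. c * a n"
    by unfold_locales (auto simp: fun_eq_iff algebra_simps)
  show "semi_inner_space (\<lambda>c (a :: nat \<Rightarrow> complex) n. c * a n) ell2 ell2_ip"
  proof
    show "vs.subspace ell2"
      unfolding vs.subspace_def
      using ell2_add ell2_scale by (auto simp: ell2_iff plus_fun_def)
    fix x y z :: "nat \<Rightarrow> complex" and c
    show "ell2_ip (x + y) z = ell2_ip x z + ell2_ip y z" if "x \<in> ell2" "y \<in> ell2" "z \<in> ell2"
      using sums_add[OF ell2_ip_sums[OF that(1,3)] ell2_ip_sums[OF that(2,3)]]
      by (simp add: ell2_ip_def sums_iff algebra_simps)
    show "ell2_ip (\<lambda>n. c * x n) z = c * ell2_ip x z" if "x \<in> ell2" "z \<in> ell2"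
      using sums_mult[OF ell2_ip_sums[OF that], of c]
      by (simp add: ell2_ip_def sums_iff algebra_simps)
    show "ell2_ip y x = cnj (ell2_ip x y)" if "x \<in> ell2" "y \<in> ell2"
    proof -
      have "(\<lambda>n. cnj (x n * cnj (y n))) sums cnj (ell2_ip x y)"
        using ell2_ip_sums[OF that] by (simp only: sums_cnj)
      then show ?thesis by (simp add: ell2_ip_def sums_iff mult.commute)
    qed
    show "0 \<le> Re (ell2_ip x x)" if "x \<in> ell2"
      using that by (simp add: ell2_ip_self suminf_nonneg ell2_iff)
  qed
qed

lemma ell2_norm_eq: "a \<in> ell2 \<Longrightarrow> ell2_norm a = ell2.nrm a"
  by (simp add: ell2_norm_def ell2.nrm_def ell2_ip_self)

lemma ell2_norm_sq: "a \<in> ell2 \<Longrightarrow> (ell2_norm a)\<^sup>2 = (\<Sum>n. (cmod (a n))\<^sup>2)"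
  by (simp add: ell2_norm_def ell2_iff suminf_nonneg)

lemma ell2_partial_le:
  assumes "a \<in> ell2"
  shows "(\<Sum>n<N. (cmod (a n))\<^sup>2) \<le> (ell2_norm a)\<^sup>2"
  unfolding ell2_norm_sq[OF assms] by (rule sum_le_suminf) (use assms in \<open>auto simp: ell2_iff\<close>)

lemma ell2_coordinate_le:
  assumes "a \<in> ell2"
  shows "cmod (a n) \<le> ell2_norm a"
proof (rule power2_le_imp_le)
  have "(\<Sum>i\<in>{n}. (cmod (a i))\<^sup>2) \<le> (\<Sum>i<Suc n. (cmod (a i))\<^sup>2)"
    by (rule sum_mono2) auto
  with ell2_partial_le[OF assms, of "Suc n"] show "(cmod (a n))\<^sup>2 \<le> (ell2_norm a)\<^sup>2" by simp
  show "0 \<le> ell2_norm a" using assms by (simp add: ell2_norm_eq)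
qed

lemma ell2I_bounded:
  assumes "\<And>N. (\<Sum>n<N. (cmod (a n))\<^sup>2) \<le> K"
  shows "a \<in> ell2" "(\<Sum>n. (cmod (a n))\<^sup>2) \<le> K"
proof -
  show "a \<in> ell2"
    unfolding ell2_iff by (rule summableI_nonneg_bounded[OF _ assms]) auto
  then show "(\<Sum>n. (cmod (a n))\<^sup>2) \<le> K"
    by (intro suminf_le_const assms) (simp add: ell2_iff)
qed

text \<open>A Cauchy sequence converges coordinatewise; bounding partial sums first and letting their length
grow afterwards turns this into convergence in norm.\<close>

interpretation ell2: hilbert_space "\<lambda>c (a :: nat \<Rightarrow> complex) n. c * a n" ell2 ell2_ip
proof
  show "x = 0" if x: "x \<in> ell2" and 0: "ell2_ip x x = 0" for x
  proof
    fix n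
    have "ell2_norm x = 0" using x 0 by (simp add: ell2_norm_eq ell2.nrm_def)
    with ell2_coordinate_le[OF x, of n] show "x n = 0 n" by simp
  qed
  fix X :: "nat \<Rightarrow> nat \<Rightarrow> complex"
  assume X: "\<And>n. X n \<in> ell2" and cau: "ell2.nrm_Cauchy X"
  have D: "X m - X n \<in> ell2" for m n by (intro ell2.diff_in X)
  have small: "\<exists>N. \<forall>m\<ge>N. \<forall>n\<ge>N. ell2_norm (X m - X n) < e" if "e > 0" for e
    using cau that D unfolding ell2.nrm_Cauchy_def by (simp add: ell2_norm_eq)
  have "Cauchy (\<lambda>n. X n i)" for i
  proof (rule metric_CauchyI)
    fix e :: real assume "e > 0"
    then obtain N where N: "\<forall>m\<ge>N. \<forall>n\<ge>N. ell2_norm (X m - X n) < e" using small by blast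
    then have "dist (X m i) (X n i) < e" if "m \<ge> N" "n \<ge> N" for m n
      using ell2_coordinate_le[OF D[of m n], of i] that by (fastforce simp: dist_norm)
    then show "\<exists>N. \<forall>m\<ge>N. \<forall>n\<ge>N. dist (X m i) (X n i) < e" by blast
  qed
  then have "\<exists>l. (\<lambda>n. X n i) \<longlonglongrightarrow> l" for i
    using Cauchy_convergent_iff convergent_def by blast
  then obtain l where l: "\<And>i. (\<lambda>n. X n i) \<longlonglongrightarrow> l i" by metis
  have near: "X m - l \<in> ell2 \<and> ell2_norm (X m - l) \<le> e"
    if e: "e > 0" and N: "\<forall>m\<ge>N. \<forall>n\<ge>N. ell2_norm (X m - X n) < e" and m: "m \<ge> N" for e N m
  proof -
    have *: "(\<Sum>i<I. (cmod ((X m - l) i))\<^sup>2) \<le> e\<^sup>2" for I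
    proof (rule tendsto_upperbound)
      show "(\<lambda>n. \<Sum>i<I. (cmod ((X m - X n) i))\<^sup>2) \<longlonglongrightarrow> (\<Sum>i<I. (cmod ((X m - l) i))\<^sup>2)"
        by (auto intro!: tendsto_intros l)
      have "(\<Sum>i<I. (cmod ((X m - X n) i))\<^sup>2) \<le> e\<^sup>2" if n: "n \<ge> N" for n
      proof -
        have "(ell2_norm (X m - X n))\<^sup>2 \<le> e\<^sup>2"
          using N m n D by (intro power_mono) (auto simp: ell2_norm_eq less_imp_le)
        with ell2_partial_le[OF D[of m n], of I] show ?thesis by linarith
      qed
      then show "\<forall>\<^sub>F n in sequentially. (\<Sum>i<I. (cmod ((X m - X n) i))\<^sup>2) \<le> e\<^sup>2"
        by (auto simp: eventually_sequentially)
    qed simp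
    note b = ell2I_bounded[OF *]
    have "ell2_norm (X m - l) \<le> e"
      unfolding ell2_norm_def using b(2) e real_sqrt_le_mono by fastforce
    with b(1) show ?thesis by blast
  qed
  obtain N1 where "\<forall>m\<ge>N1. \<forall>n\<ge>N1. ell2_norm (X m - X n) < 1" using small[of 1] by auto
  then have "X N1 - l \<in> ell2" using near[of 1 N1 N1] by simp
  then have "l \<in> ell2" using ell2.diff_in[OF X[of N1], of "X N1 - l"] by simp
  moreover have "ell2.tends X l"
    unfolding ell2.tends_def
  proof (rule LIMSEQ_I)
    fix r :: real assume r: "r > 0"
    obtain N where N: "\<forall>m\<ge>N. \<forall>n\<ge>N. ell2_norm (X m - X n) < r / 2"
      using small[of "r / 2"] r by auto
    have "norm (ell2.nrm (X m - l) - 0) < r" if "m \<ge> N" for m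
      using near[OF _ N that] r by (auto simp: ell2_norm_eq)
    then show "\<exists>N. \<forall>m\<ge>N. norm (ell2.nrm (X m - l) - 0) < r" by blast
  qed
  ultimately show "\<exists>l\<in>ell2. ell2.tends X l" by blast
qed

text \<open>A theorem of Landau. If \<open>\<Sum> \<bar>b n\<bar>\<^sup>2\<close> diverges with partial sums \<open>S\<close>, then the Abel-Dini choice
\<open>c n = cnj (b n) / S (Suc n)\<close> is square summable because \<open>\<bar>c n\<bar>\<^sup>2 \<le> 1 / S n - 1 / S (Suc n)\<close> telescopes,
while the tails of \<open>\<Sum> c n b n\<close> do not become small: a block over which \<open>S\<close> doubles contributes
at least one half.\<close>

theorem landau_square_summable:
  fixes b :: "nat \<Rightarrow> complex"
  assumes "\<And>c. c \<in> ell2 \<Longrightarrow> summable (\<lambda>n. c n * b n)"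
  shows "b \<in> ell2"
proof (rule ccontr)
  define w where "w n = (cmod (b n))\<^sup>2" for n
  define S where "S n = (\<Sum>i<n. w i)" for n
  assume "b \<notin> ell2"
  then have div: "\<not> summable w" by (simp add: ell2_iff w_def[abs_def])
  have w_nonneg: "0 \<le> w n" for n by (simp add: w_def)
  have S_Suc: "S (Suc n) = S n + w n" for n by (simp add: S_def)
  have S_mono: "S m \<le> S n" if "m \<le> n" for m n
    unfolding S_def by (rule sum_mono2) (use that w_nonneg in auto)
  have unbounded: "\<exists>n. K < S n" for K
    using div summableI_nonneg_bounded[of w K] w_nonneg unfolding S_def by (meson not_le)
  then obtain n0 where n0: "S n0 > 0" by blast
  have S_pos: "S n > 0" if "n \<ge> n0" for n using S_mono[OF that] n0 by linarith
  define c where "c n = (if n \<ge> n0 then cnj (b n) / of_real (S (Suc n)) else 0)" for n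
  have c_sq: "(cmod (c n))\<^sup>2 = w n / (S (Suc n))\<^sup>2" if "n \<ge> n0" for n
    using that S_pos[of "Suc n"] by (simp add: c_def w_def norm_divide power_divide)
  have telescope: "w n / (S (Suc n))\<^sup>2 \<le> 1 / S n - 1 / S (Suc n)" if "n \<ge> n0" for n
  proof -
    have pos: "S n > 0" "S (Suc n) > 0" using S_pos that by auto
    have "w n / (S (Suc n))\<^sup>2 \<le> w n / (S n * S (Suc n))"
      unfolding power2_eq_square
      using pos w_nonneg[of n] S_mono[of n "Suc n"] by (intro divide_left_mono mult_right_mono) auto
    also have "\<dots> = 1 / S n - 1 / S (Suc n)"
      using pos by (simp add: S_Suc field_simps)
    finally show ?thesis .
  qed
  have "c \<in> ell2"
  proof (rule ell2I_bounded)
    have "(\<Sum>n<n0+k. (cmod (c n))\<^sup>2) \<le> 1 / S n0 - 1 / S (n0 + k)" for k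
    proof (induction k)
      case 0
      show ?case by (simp add: c_def)
    next
      case (Suc k)
      then show ?case using c_sq[of "n0 + k"] telescope[of "n0 + k"] by simp
    qed
    moreover have "(\<Sum>n<N. (cmod (c n))\<^sup>2) \<le> (\<Sum>n<n0+N. (cmod (c n))\<^sup>2)" for N
      by (rule sum_mono2) auto
    moreover have "1 / S (n0 + N) > 0" for N using S_pos by simp
    ultimately show "(\<Sum>n<N. (cmod (c n))\<^sup>2) \<le> 1 / S n0" for N
      by (meson add_increasing2 diff_le_eq less_imp_le order_refl order_trans)
  qed
  then have "summable (\<lambda>n. c n * b n)" by (rule assms)
  then have cau: "Cauchy (\<lambda>N. \<Sum>n<N. c n * b n)"
    by (simp add: summable_iff_convergent Cauchy_convergent_iff)
  obtain M where M: "\<And>m n. m \<ge> M \<Longrightarrow> n \<ge> M \<Longrightarrow> dist (\<Sum>i<m. c i * b i) (\<Sum>i<n. c i * b i) < 1 / 2"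
    using metric_CauchyD[OF cau, of "1/2"] by auto
  define m where "m = max M n0"
  obtain n where n: "2 * S m < S n" using unbounded by blast
  have "S m > 0" using S_pos by (simp add: m_def)
  have mn: "m < n"
  proof (rule ccontr)
    assume "\<not> m < n"
    with S_mono[of n m] n \<open>S m > 0\<close> show False by simp
  qed
  have term_eq: "c i * b i = of_real (w i / S (Suc i))" if "i \<ge> n0" for i
  proof -
    have "cnj (b i) * b i = of_real (w i)"
      unfolding w_def complex_norm_square by (rule mult.commute)
    then show ?thesis using that by (simp add: c_def)
  qed
  have "1 / 2 \<le> (S n - S m) / S n"
    using n \<open>S m > 0\<close> by (simp add: field_simps)
  also have "(S n - S m) / S n = (\<Sum>i=m..<n. w i / S n)"
    using mn sum.atLeastLessThan_concat[of 0 m n w]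
    by (simp add: S_def sum_divide_distrib[symmetric] atLeast0LessThan)
  also have "\<dots> \<le> (\<Sum>i=m..<n. w i / S (Suc i))"
    using w_nonneg S_pos mn by (intro sum_mono divide_left_mono S_mono mult_pos_pos) (auto simp: m_def)
  finally have half: "1 / 2 \<le> (\<Sum>i=m..<n. w i / S (Suc i))" .
  have "dist (\<Sum>i<n. c i * b i) (\<Sum>i<m. c i * b i) = (\<Sum>i=m..<n. w i / S (Suc i))"
  proof -
    have "(\<Sum>i<n. c i * b i) - (\<Sum>i<m. c i * b i) = (\<Sum>i=m..<n. c i * b i)"
      using mn sum.atLeastLessThan_concat[of 0 m n "\<lambda>i. c i * b i"] by (simp add: atLeast0LessThan[symmetric] algebra_simps)
    also have "\<dots> = of_real (\<Sum>i=m..<n. w i / S (Suc i))"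
      using term_eq by (simp add: m_def)
    finally show ?thesis
      using half unfolding dist_norm by (simp only: norm_of_real abs_of_nonneg)
  qed
  moreover have "dist (\<Sum>i<n. c i * b i) (\<Sum>i<m. c i * b i) < 1 / 2"
    using mn by (intro M) (auto simp: m_def)
  ultimately show False using half by simp
qed

section \<open>Synthesis over a Bessel sequence\<close>

context hilbert_space
begin

lemma besselE:
  assumes "bessel k"
  obtains B where "B > 0" "\<And>n. k n \<in> V" "\<And>f. f \<in> V \<Longrightarrow> (\<lambda>n. ip f (k n)) \<in> ell2"
    "\<And>f. f \<in> V \<Longrightarrow> ell2_norm (\<lambda>n. ip f (k n)) \<le> B * nrm f"
proof -
  have k: "\<And>n. k n \<in> V" using assms by (simp add: bessel_def)
  from assms have "\<exists>B>0. \<forall>f\<in>V. summable (\<lambda>n. (cmod (ip f (k n)))\<^sup>2) \<and>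
      (\<Sum>n. (cmod (ip f (k n)))\<^sup>2) \<le> B * (nrm f)\<^sup>2"
    by (simp add: bessel_def)
  then obtain B where "0 < B \<and> (\<forall>f\<in>V. summable (\<lambda>n. (cmod (ip f (k n)))\<^sup>2) \<and>
      (\<Sum>n. (cmod (ip f (k n)))\<^sup>2) \<le> B * (nrm f)\<^sup>2)" ..
  then have B: "B > 0"
    and *: "\<forall>f\<in>V. summable (\<lambda>n. (cmod (ip f (k n)))\<^sup>2) \<and>
      (\<Sum>n. (cmod (ip f (k n)))\<^sup>2) \<le> B * (nrm f)\<^sup>2" by auto
  show thesis
  proof (rule that[of "sqrt B"])
    fix f assume f: "f \<in> V"
    with * show "(\<lambda>n. ip f (k n)) \<in> ell2" by (simp add: ell2_iff)
    have "sqrt (\<Sum>n. (cmod (ip f (k n)))\<^sup>2) \<le> sqrt (B * (nrm f)\<^sup>2)"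
      using * f by (intro real_sqrt_le_mono) blast
    then show "ell2_norm (\<lambda>n. ip f (k n)) \<le> sqrt B * nrm f"
      using f by (simp add: ell2_norm_def real_sqrt_mult)
  qed (use B k in auto)
qed

text \<open>With \<open>s\<close> the sum, expand one argument of \<open>\<langle>s, s\<rangle>\<close> and apply the Cauchy-Schwarz inequality; the
coefficients of \<open>s\<close> are controlled by the norm of \<open>s\<close>, one factor of which cancels.\<close>

lemma bessel_synthesis_bound:
  assumes k: "\<And>n. k n \<in> V"
    and an: "\<And>f. f \<in> V \<Longrightarrow> (\<lambda>n. ip f (k n)) \<in> ell2"
      "\<And>f. f \<in> V \<Longrightarrow> ell2_norm (\<lambda>n. ip f (k n)) \<le> B * nrm f"
    and "finite I"
  shows "(nrm (\<Sum>n\<in>I. c n \<odot> k n))\<^sup>2 \<le> B\<^sup>2 * (\<Sum>n\<in>I. (cmod (c n))\<^sup>2)"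
proof -
  define s where "s = (\<Sum>n\<in>I. c n \<odot> k n)"
  have s: "s \<in> V" unfolding s_def using k by (intro sum_in) auto
  have "(nrm s)\<^sup>2 = cmod (ip s s)" using ip_self[OF s] by (metis abs_of_nonneg norm_of_real zero_le_power2)
  also have "ip s s = (\<Sum>n\<in>I. c n * ip (k n) s)"
    unfolding s_def[abs_def] using k s[unfolded s_def]
    by (subst ip_sum_left) (auto simp: ip_scale_left)
  also have "cmod \<dots> \<le> (\<Sum>n\<in>I. \<bar>cmod (c n)\<bar> * \<bar>cmod (ip s (k n))\<bar>)"
  proof (intro order_trans[OF norm_sum] sum_mono)
    fix n
    show "cmod (c n * ip (k n) s) \<le> \<bar>cmod (c n)\<bar> * \<bar>cmod (ip s (k n))\<bar>"
      using ip_commute[OF s k[of n]] by (simp add: norm_mult)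
  qed
  also have "\<dots> \<le> L2_set (\<lambda>n. cmod (c n)) I * L2_set (\<lambda>n. cmod (ip s (k n))) I"
    by (rule L2_set_mult_ineq)
  also have "L2_set (\<lambda>n. cmod (ip s (k n))) I \<le> ell2_norm (\<lambda>n. ip s (k n))"
    unfolding L2_set_def ell2_norm_def
    using an(1)[OF s] assms(4) by (intro real_sqrt_le_mono sum_le_suminf) (auto simp: ell2_iff)
  also have "\<dots> \<le> B * nrm s" by (rule an(2)[OF s])
  finally have *: "(nrm s)\<^sup>2 \<le> L2_set (\<lambda>n. cmod (c n)) I * (B * nrm s)"
    by (simp add: mult_left_mono)
  have "nrm s \<le> L2_set (\<lambda>n. cmod (c n)) I * B" if "nrm s \<noteq> 0"
  proof (rule mult_right_le_imp_le)
    show "nrm s * nrm s \<le> L2_set (\<lambda>n. cmod (c n)) I * B * nrm s"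
      using * unfolding power2_eq_square mult.assoc .
    show "0 < nrm s" using that nrm_nonneg[OF s] by linarith
  qed
  then have "(nrm s)\<^sup>2 \<le> (L2_set (\<lambda>n. cmod (c n)) I * B)\<^sup>2"
    using nrm_nonneg[OF s] by (cases "nrm s = 0") (auto intro: power_mono)
  also have "\<dots> = B\<^sup>2 * (\<Sum>n\<in>I. (cmod (c n))\<^sup>2)"
    by (simp add: power_mult_distrib L2_set_def sum_nonneg mult.commute)
  finally show ?thesis by (simp add: s_def)
qed

lemma bessel_synthesis:
  assumes "bessel k" "c \<in> ell2"
  obtains s where "nrm_sums (\<lambda>n. c n \<odot> k n) s"
proof -
  obtain B where B: "B > 0" and k: "\<And>n. k n \<in> V"
    and an: "\<And>f. f \<in> V \<Longrightarrow> (\<lambda>n. ip f (k n)) \<in> ell2"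
      "\<And>f. f \<in> V \<Longrightarrow> ell2_norm (\<lambda>n. ip f (k n)) \<le> B * nrm f"
    using besselE[OF assms(1)] by metis
  let ?X = "\<lambda>N. \<Sum>n<N. c n \<odot> k n"
  have X: "?X N \<in> V" for N using k by (intro sum_in) auto
  have small: "\<exists>M. \<forall>m\<ge>M. \<forall>n\<ge>m. nrm (?X n - ?X m) < e" if e: "e > 0" for e
  proof -
    have "Cauchy (\<lambda>N. \<Sum>n<N. (cmod (c n))\<^sup>2)"
      using assms(2) by (simp add: ell2_iff summable_iff_convergent Cauchy_convergent_iff)
    moreover have "e\<^sup>2 / B\<^sup>2 > 0" using e B by simp
    ultimately obtain M where M: "\<And>m n. m \<ge> M \<Longrightarrow> n \<ge> M \<Longrightarrow>
        dist (\<Sum>i<m. (cmod (c i))\<^sup>2) (\<Sum>i<n. (cmod (c i))\<^sup>2) < e\<^sup>2 / B\<^sup>2"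
      by (meson metric_CauchyD)
    have "nrm (?X n - ?X m) < e" if mn: "m \<ge> M" "n \<ge> m" for m n
    proof -
      have split: "sum u {..<n} - sum u {..<m} = sum u {m..<n}" for u :: "nat \<Rightarrow> 'w::ab_group_add"
        using mn(2) sum.atLeastLessThan_concat[of 0 m n u] by (simp add: atLeast0LessThan[symmetric] algebra_simps)
      have "(nrm (?X n - ?X m))\<^sup>2 \<le> B\<^sup>2 * (\<Sum>i=m..<n. (cmod (c i))\<^sup>2)"
        unfolding split by (rule bessel_synthesis_bound[OF k an]) auto
      also have "(\<Sum>i=m..<n. (cmod (c i))\<^sup>2) = dist (\<Sum>i<n. (cmod (c i))\<^sup>2) (\<Sum>i<m. (cmod (c i))\<^sup>2)"
        unfolding dist_real_def split by (simp add: sum_nonneg)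
      also have "B\<^sup>2 * \<dots> < B\<^sup>2 * (e\<^sup>2 / B\<^sup>2)"
        using M mn B by (intro mult_strict_left_mono) auto
      also have "\<dots> = e\<^sup>2" using B by simp
      finally show ?thesis using e by (meson less_imp_le power2_less_imp_less)
    qed
    then show ?thesis by blast
  qed
  have "nrm_Cauchy ?X"
    unfolding nrm_Cauchy_def
  proof (intro allI impI)
    fix e :: real assume "e > 0"
    then obtain M where "\<forall>m\<ge>M. \<forall>n\<ge>m. nrm (?X n - ?X m) < e" using small by blast
    then have "nrm (?X m - ?X n) < e" if "m \<ge> M" "n \<ge> M" for m n
      using that nrm_minus_commute[OF X X] by (metis nat_le_linear)
    then show "\<exists>M. \<forall>m\<ge>M. \<forall>n\<ge>M. nrm (?X m - ?X n) < e" by blast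
  qed
  then obtain s where "s \<in> V" "tends ?X s" using complete[of ?X] X by blast
  then show thesis using k that by (simp add: nrm_sums_def)
qed

end

section \<open>Atomic systems for an operator\<close>

context hilbert_space
begin

text \<open>This is the step from an inequality to a factorisation (Douglas' lemma). Let \<open>T f\<close> be the sequence
of coefficients \<open>\<langle>f, k n\<rangle>\<close>. Since \<open>\<parallel>M h\<parallel> \<le> C \<parallel>T h\<parallel>\<close>, for each \<open>f\<close> the functional \<open>h \<mapsto> \<langle>M h, f\<rangle>\<close> is bounded
for the form pulled back along \<open>T\<close>, so it is represented by an element \<open>A f\<close> of the closure of the
range of \<open>T\<close> in \<open>\<ell>\<^sup>2\<close>. Within that closure \<open>A f\<close> is unique, hence \<open>A\<close> is linear; it is also bounded, so its
coordinates are bounded functionals and the Riesz theorem turns them into vectors \<open>g n\<close>.\<close>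

theorem bounded_by_bessel_coefficients_factors:
  assumes k: "bessel k"
    and M_in: "\<And>f. f \<in> V \<Longrightarrow> M f \<in> V"
    and M_add: "\<And>f g. f \<in> V \<Longrightarrow> g \<in> V \<Longrightarrow> M (f + g) = M f + M g"
    and M_scale: "\<And>c f. f \<in> V \<Longrightarrow> M (c \<odot> f) = c \<odot> M f"
    and bound: "\<And>f. f \<in> V \<Longrightarrow> nrm (M f) \<le> C * ell2_norm (\<lambda>n. ip f (k n))"
    and C: "C > 0"
  obtains g where "bessel g"
    "\<And>f h. f \<in> V \<Longrightarrow> h \<in> V \<Longrightarrow> (\<lambda>n. ip h (k n) * cnj (ip f (g n))) sums ip (M h) f"
proof -
  define T where "T f = (\<lambda>n. ip f (k n))" for f
  have k_in: "k n \<in> V" for n using k by (simp add: bessel_def)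
  have T_in: "T f \<in> ell2" if "f \<in> V" for f
    using besselE[OF k] that unfolding T_def by metis
  have T_add: "T (x + y) = T x + T y" if "x \<in> V" "y \<in> V" for x y
    using that k_in by (simp add: T_def ip_add_left fun_eq_iff)
  have T_scale: "T (c \<odot> x) = (\<lambda>n. c * T x n)" if "x \<in> V" for c x
    using that k_in by (simp add: T_def ip_scale_left fun_eq_iff)
  have T_diff: "T (x - y) = T x - T y" if "x \<in> V" "y \<in> V" for x y
    using that k_in by (simp add: T_def ip_diff_left fun_eq_iff)
  interpret pull: semi_inner_space scale V "\<lambda>x y. ell2_ip (T x) (T y)"
  proof
    show "subspace V" by (rule subspace_V)
  qed (use T_in in \<open>auto simp: T_add T_scale ell2.ip_add_left ell2.ip_scale_left ell2.ip_nonneg intro: ell2.ip_commute\<close>)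
  have pull_nrm: "pull.nrm x = ell2.nrm (T x)" for x
    by (simp add: pull.nrm_def ell2.nrm_def)
  \<comment> \<open>The last conjunct places \<open>a\<close> in the closure of the range of \<open>T\<close> and makes it unique.\<close>
  define coef where "coef f a \<longleftrightarrow> a \<in> ell2 \<and> (\<forall>h\<in>V. ell2_ip (T h) a = ip (M h) f) \<and>
    (\<exists>G. (\<forall>j. G j \<in> V) \<and> ell2.tends (\<lambda>j. T (G j)) a)" for f a
  have coef_ex: "\<exists>a. coef f a" if f: "f \<in> V" for f
  proof -
    have bd: "cmod (ip (M x) f) \<le> (nrm f * C) * pull.nrm x" if x: "x \<in> V" for x
    proof -
      have "cmod (ip (M x) f) \<le> nrm (M x) * nrm f"
        using M_in[OF x] f by (rule Cauchy_Schwarz)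
      also have "\<dots> \<le> C * ell2_norm (T x) * nrm f"
        using bound[OF x] f by (intro mult_right_mono) (auto simp: T_def)
      finally show ?thesis
        by (simp add: pull_nrm ell2_norm_eq T_in x mult_ac)
    qed
    obtain G where G: "\<And>j. G j \<in> V" "pull.nrm_Cauchy G"
      "\<And>x. x \<in> V \<Longrightarrow> (\<lambda>j. ell2_ip (T x) (T (G j))) \<longlonglongrightarrow> ip (M x) f"
      by (rule pull.riesz_approximation[where \<phi>="\<lambda>x. ip (M x) f" and M="nrm f * C"])
         (use f M_in bd in \<open>auto simp: M_add M_scale ip_add_left ip_scale_left\<close>)
    have "ell2.nrm_Cauchy (\<lambda>j. T (G j))"
      using G(2) G(1) unfolding pull.nrm_Cauchy_def ell2.nrm_Cauchy_def
      by (simp add: pull_nrm T_diff)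
    then obtain a where a: "a \<in> ell2" "ell2.tends (\<lambda>j. T (G j)) a"
      using ell2.complete[of "\<lambda>j. T (G j)"] T_in G(1) by blast
    have "ell2_ip (T h) a = ip (M h) f" if h: "h \<in> V" for h
      using ell2.tends_ip_right[OF a(2) T_in[OF G(1)] a(1) T_in[OF h]] G(3)[OF h] LIMSEQ_unique by blast
    with a G(1) show ?thesis unfolding coef_def by blast
  qed
  have coef_unique: "a = b" if a: "coef f a" and b: "coef f b" for f a b
  proof -
    have ab: "a \<in> ell2" "b \<in> ell2" using a b by (auto simp: coef_def)
    have orth: "ell2_ip (T h) (a - b) = 0" if "h \<in> V" for h
      using a b that ab T_in by (simp add: coef_def ell2.ip_diff_right)
    obtain G H where G: "\<And>j. G j \<in> V" "ell2.tends (\<lambda>j. T (G j)) a"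
      and H: "\<And>j. H j \<in> V" "ell2.tends (\<lambda>j. T (H j)) b"
      using a b unfolding coef_def by blast
    have "(\<lambda>j. ell2_ip (T (G j)) (a - b)) \<longlonglongrightarrow> ell2_ip a (a - b)"
      "(\<lambda>j. ell2_ip (T (H j)) (a - b)) \<longlonglongrightarrow> ell2_ip b (a - b)"
      using G H ab T_in by (auto intro!: ell2.tends_ip)
    then have "ell2_ip a (a - b) = 0" "ell2_ip b (a - b) = 0"
      using orth G(1) H(1) by (simp_all add: LIMSEQ_const_iff)
    then have "ell2_ip (a - b) (a - b) = 0"
      using ab by (simp add: ell2.ip_diff_left)
    then have "a - b = 0" using ab by (intro ell2.definite) auto
    then show ?thesis by simp
  qed
  define A where "A f = (THE a. coef f a)" for f
  have A: "coef f (A f)" if "f \<in> V" for f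
    unfolding A_def using coef_ex[OF that] coef_unique by (metis theI)
  have A_in: "A f \<in> ell2" if "f \<in> V" for f using A[OF that] by (simp add: coef_def)
  have A_ip: "ell2_ip (T h) (A f) = ip (M h) f" if "f \<in> V" "h \<in> V" for f h
    using A[OF that(1)] that(2) by (simp add: coef_def)
  have A_add: "A (x + y) = A x + A y" if x: "x \<in> V" and y: "y \<in> V" for x y
  proof (rule coef_unique[OF A])
    obtain G H where G: "\<And>j. G j \<in> V" "ell2.tends (\<lambda>j. T (G j)) (A x)"
      and H: "\<And>j. H j \<in> V" "ell2.tends (\<lambda>j. T (H j)) (A y)"
      using A[OF x] A[OF y] unfolding coef_def by blast
    have "ell2.tends (\<lambda>j. T (G j + H j)) (A x + A y)"
      using ell2.tends_add[OF G(2) H(2)] G(1) H(1) x y by (simp add: T_in A_in T_add)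
    then have "\<exists>G. (\<forall>j. G j \<in> V) \<and> ell2.tends (\<lambda>j. T (G j)) (A x + A y)"
      using G(1) H(1) by (intro exI[of _ "\<lambda>j. G j + H j"]) auto
    then show "coef (x + y) (A x + A y)"
      unfolding coef_def using x y
      by (simp add: A_in T_in ell2.ip_add_right A_ip ip_add_right M_in)
  qed (use x y in simp)
  have A_scale: "A (c \<odot> x) = (\<lambda>n. c * A x n)" if x: "x \<in> V" for c x
  proof (rule coef_unique[OF A])
    obtain G where G: "\<And>j. G j \<in> V" "ell2.tends (\<lambda>j. T (G j)) (A x)"
      using A[OF x] unfolding coef_def by blast
    have "ell2.tends (\<lambda>j. T (c \<odot> G j)) (\<lambda>n. c * A x n)"
      using ell2.tends_scale[OF G(2), of c] G(1) x by (simp add: T_in A_in T_scale)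
    then have "\<exists>G. (\<forall>j. G j \<in> V) \<and> ell2.tends (\<lambda>j. T (G j)) (\<lambda>n. c * A x n)"
      using G(1) by (intro exI[of _ "\<lambda>j. c \<odot> G j"]) auto
    then show "coef (c \<odot> x) (\<lambda>n. c * A x n)"
      unfolding coef_def using x
      by (simp add: A_in T_in ell2.ip_scale_right A_ip ip_scale_right M_in ell2_scale)
  qed (use x in simp)
  have A_bound: "ell2_norm (A f) \<le> C * nrm f" if f: "f \<in> V" for f
  proof -
    obtain G where G: "\<And>j. G j \<in> V" "ell2.tends (\<lambda>j. T (G j)) (A f)"
      using A[OF f] unfolding coef_def by blast
    have "(\<lambda>j. cmod (ell2_ip (T (G j)) (A f))) \<longlonglongrightarrow> cmod (ell2_ip (A f) (A f))"
      using G T_in A_in f by (intro tendsto_norm ell2.tends_ip) auto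
    moreover have "(\<lambda>j. C * ell2.nrm (T (G j)) * nrm f) \<longlonglongrightarrow> C * ell2.nrm (A f) * nrm f"
      using G T_in A_in f by (intro tendsto_intros ell2.tends_nrm) auto
    moreover have "cmod (ell2_ip (T (G j)) (A f)) \<le> C * ell2.nrm (T (G j)) * nrm f" for j
    proof -
      have "cmod (ip (M (G j)) f) \<le> nrm (M (G j)) * nrm f"
        using M_in[OF G(1)] f by (rule Cauchy_Schwarz)
      also have "\<dots> \<le> C * ell2.nrm (T (G j)) * nrm f"
        using bound[OF G(1), of j] T_in[OF G(1)] f
        by (intro mult_right_mono) (auto simp: T_def ell2_norm_eq)
      finally show ?thesis using f G(1) by (simp add: A_ip)
    qed
    ultimately have "cmod (ell2_ip (A f) (A f)) \<le> C * ell2.nrm (A f) * nrm f"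
      by (intro LIMSEQ_le) auto
    then have sq: "ell2.nrm (A f) * ell2.nrm (A f) \<le> C * nrm f * ell2.nrm (A f)"
      unfolding ell2.ip_self[OF A_in[OF f]] norm_of_real by (simp add: power2_eq_square mult_ac)
    show ?thesis
    proof (cases "ell2.nrm (A f) = 0")
      case True
      then show ?thesis using C f by (simp add: ell2_norm_eq A_in)
    next
      case False
      then have "ell2.nrm (A f) > 0" using ell2.nrm_nonneg[OF A_in[OF f]] by linarith
      with sq show ?thesis by (simp add: ell2_norm_eq A_in f)
    qed
  qed
  have "\<exists>u\<in>V. \<forall>f\<in>V. A f n = ip f u" for n
  proof -
    obtain u where "u \<in> V" "\<And>f. f \<in> V \<Longrightarrow> A f n = ip f u"
    proof (rule riesz_representation[where \<phi>="\<lambda>f. A f n" and M=C])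
      show "cmod (A f n) \<le> C * nrm f" if "f \<in> V" for f
        using ell2_coordinate_le[OF A_in[OF that], of n] A_bound[OF that] by linarith
    qed (auto simp: A_add A_scale)
    then show ?thesis by blast
  qed
  then obtain g where g: "\<And>n. g n \<in> V" "\<And>n f. f \<in> V \<Longrightarrow> A f n = ip f (g n)" by metis
  have A_eq: "A f = (\<lambda>n. ip f (g n))" if "f \<in> V" for f using g(2)[OF that] by blast
  \<comment> \<open>The coefficients of \<open>f\<close> against \<open>g\<close> form the sequence \<open>A f\<close>, which lies in \<open>\<ell>\<^sup>2\<close>.\<close>
  have "bessel g"
    by (rule bessel_if_square_summable) (use g(1) A_in in \<open>auto simp: A_eq ell2_iff\<close>)
  moreover have "(\<lambda>n. ip h (k n) * cnj (ip f (g n))) sums ip (M h) f" if "f \<in> V" "h \<in> V" for f h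
    using ell2_ip_sums[OF T_in[OF that(2)] A_in[OF that(1)]] that
    unfolding A_ip[OF that] unfolding A_eq[OF that(1)] T_def by blast
  ultimately show thesis using that by blast
qed

text \<open>A relation rather than an operator, so that the two maps can be interchanged; linearity of both
follows from it.\<close>

definition adjoint_pair :: "('v \<Rightarrow> 'v) \<Rightarrow> ('v \<Rightarrow> 'v) \<Rightarrow> bool" where
  "adjoint_pair L M \<longleftrightarrow> (\<forall>f\<in>V. L f \<in> V) \<and> (\<forall>f\<in>V. M f \<in> V) \<and>
    (\<forall>f\<in>V. \<forall>h\<in>V. ip (L f) h = ip f (M h))"

lemma adjoint_pairD:
  assumes "adjoint_pair L M"
  shows "f \<in> V \<Longrightarrow> L f \<in> V" "f \<in> V \<Longrightarrow> M f \<in> V"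
    "f \<in> V \<Longrightarrow> h \<in> V \<Longrightarrow> ip (L f) h = ip f (M h)"
  using assms by (auto simp: adjoint_pair_def)

lemma adjoint_pair_commute:
  assumes "adjoint_pair L M"
  shows "adjoint_pair M L"
  unfolding adjoint_pair_def using adjoint_pairD[OF assms] by (metis ip_commute)

lemma adjoint_pair_add:
  assumes "adjoint_pair L M" "x \<in> V" "y \<in> V"
  shows "M (x + y) = M x + M y"
  by (rule eq_if_ip_eq)
     (use assms(2,3) adjoint_pairD[OF assms(1)] in \<open>auto simp: ip_add_right adjoint_pairD(3)[OF assms(1), symmetric]\<close>)

lemma adjoint_pair_scale:
  assumes "adjoint_pair L M" "x \<in> V"
  shows "M (c \<odot> x) = c \<odot> M x"
  by (rule eq_if_ip_eq)
     (use assms(2) adjoint_pairD[OF assms(1)] in \<open>auto simp: ip_scale_right adjoint_pairD(3)[OF assms(1), symmetric]\<close>)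

lemma adjoint_exists:
  assumes L_in: "\<And>f. f \<in> V \<Longrightarrow> L f \<in> V"
    and L_add: "\<And>f g. f \<in> V \<Longrightarrow> g \<in> V \<Longrightarrow> L (f + g) = L f + L g"
    and L_scale: "\<And>c f. f \<in> V \<Longrightarrow> L (c \<odot> f) = c \<odot> L f"
    and bound: "\<And>f. f \<in> V \<Longrightarrow> nrm (L f) \<le> C * nrm f"
    and h: "h \<in> V"
  shows "\<exists>!u. u \<in> V \<and> (\<forall>f\<in>V. ip (L f) h = ip f u)"
proof -
  obtain u where "u \<in> V" "\<And>f. f \<in> V \<Longrightarrow> ip (L f) h = ip f u"
  proof (rule riesz_representation[where \<phi>="\<lambda>f. ip (L f) h" and M="C * nrm h"])
    show "cmod (ip (L f) h) \<le> C * nrm h * nrm f" if f: "f \<in> V" for f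
    proof -
      have "cmod (ip (L f) h) \<le> nrm (L f) * nrm h" using L_in[OF f] h by (rule Cauchy_Schwarz)
      also have "\<dots> \<le> C * nrm f * nrm h" using bound[OF f] h by (intro mult_right_mono) auto
      finally show ?thesis by (simp add: mult_ac)
    qed
  qed (use L_in h in \<open>auto simp: L_add L_scale ip_add_left ip_scale_left\<close>)
  then show ?thesis by (intro ex1I[of _ u]) (auto intro: eq_if_ip_eq)
qed

text \<open>Over a Bessel sequence every square summable coefficient sequence gives a convergent series, so
whether the sum is \<open>s\<close> can be tested weakly.\<close>

lemma nrm_sums_iff_bessel_expansion:
  assumes k: "bessel k" and a: "a \<in> ell2" and s: "s \<in> V"
  shows "nrm_sums (\<lambda>n. a n \<odot> k n) s \<longleftrightarrow> (\<forall>h\<in>V. (\<lambda>n. ip h (k n) * cnj (a n)) sums ip h s)"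
proof -
  have k_in: "k n \<in> V" for n using k by (simp add: bessel_def)
  have conv: "(\<lambda>n. ip (a n \<odot> k n) h) sums ip t h \<longleftrightarrow> (\<lambda>n. ip h (k n) * cnj (a n)) sums ip h t"
    if "t \<in> V" "h \<in> V" for t h
  proof -
    have "cnj (ip (a n \<odot> k n) h) = ip h (k n) * cnj (a n)" for n
      using that k_in by (simp add: ip_scale_left ip_commute[symmetric])
    then show ?thesis
      using sums_cnj[of "\<lambda>n. ip (a n \<odot> k n) h" "ip t h"] that by (simp add: ip_commute[symmetric])
  qed
  obtain t where t: "nrm_sums (\<lambda>n. a n \<odot> k n) t" using bessel_synthesis[OF k a] .
  then have t_in: "t \<in> V" by (simp add: nrm_sums_def)
  show ?thesis
  proof
    assume "nrm_sums (\<lambda>n. a n \<odot> k n) s"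
    then show "\<forall>h\<in>V. (\<lambda>n. ip h (k n) * cnj (a n)) sums ip h s"
      using nrm_sums_ip conv[OF s] by blast
  next
    assume *: "\<forall>h\<in>V. (\<lambda>n. ip h (k n) * cnj (a n)) sums ip h s"
    have "s = t"
    proof (rule eq_if_ip_eq[OF s t_in])
      fix h assume h: "h \<in> V"
      show "ip h s = ip h t"
        using * h nrm_sums_ip[OF t h] conv[OF t_in h] sums_unique2 by blast
    qed
    with t show "nrm_sums (\<lambda>n. a n \<odot> k n) s" by simp
  qed
qed

lemma bessel_coefficients_in_ell2: "bessel g \<Longrightarrow> f \<in> V \<Longrightarrow> (\<lambda>n. ip f (g n)) \<in> ell2"
  using besselE by metis

text \<open>Both expansions express the same scalar identity
\<open>\<langle>L h, f\<rangle> = \<Sum> \<langle>h, g n\<rangle> \<langle>k n, f\<rangle>\<close>, so passing to the adjoint exchanges \<open>k\<close> and \<open>g\<close>.\<close>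

lemma dual_bessel_expansion:
  assumes "adjoint_pair L M" "bessel k" "bessel g"
    and exp: "\<forall>f\<in>V. nrm_sums (\<lambda>n. ip f (g n) \<odot> k n) (L f)"
  shows "\<forall>f\<in>V. nrm_sums (\<lambda>n. ip f (k n) \<odot> g n) (M f)"
proof
  fix f assume f: "f \<in> V"
  note adj = adjoint_pairD[OF assms(1)]
  note c = bessel_coefficients_in_ell2
  have "(\<lambda>n. ip h (g n) * cnj (ip f (k n))) sums ip h (M f)" if h: "h \<in> V" for h
  proof -
    have "(\<lambda>n. ip f (k n) * cnj (ip h (g n))) sums ip f (L h)"
      using exp f h nrm_sums_iff_bessel_expansion[OF assms(2) c[OF assms(3) h] adj(1)[OF h]] by blast
    then have "(\<lambda>n. cnj (ip f (k n) * cnj (ip h (g n)))) sums cnj (ip f (L h))"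
      by (simp only: sums_cnj)
    moreover have "cnj (ip f (L h)) = ip h (M f)"
      using adj f h ip_commute[of f "L h"] by simp
    ultimately show ?thesis by (simp add: mult.commute)
  qed
  then show "nrm_sums (\<lambda>n. ip f (k n) \<odot> g n) (M f)"
    using nrm_sums_iff_bessel_expansion[OF assms(3) c[OF assms(2) f] adj(2)[OF f]] by blast
qed

definition atomic_system :: "('v \<Rightarrow> 'v) \<Rightarrow> (nat \<Rightarrow> 'v) \<Rightarrow> bool" where
  "atomic_system L k \<longleftrightarrow> (\<forall>c\<in>ell2. \<exists>s. nrm_sums (\<lambda>n. c n \<odot> k n) s) \<and>
    (\<exists>C>0. \<forall>f\<in>V. \<exists>a\<in>ell2. ell2_norm a \<le> C * nrm f \<and> nrm_sums (\<lambda>n. a n \<odot> k n) (L f))"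

definition sampling_for :: "('v \<Rightarrow> 'v) \<Rightarrow> (nat \<Rightarrow> 'v) \<Rightarrow> bool" where
  "sampling_for M k \<longleftrightarrow> (\<exists>A>0. \<exists>B>0. \<forall>f\<in>V. summable (\<lambda>n. (cmod (ip f (k n)))\<^sup>2) \<and>
    A * (nrm (M f))\<^sup>2 \<le> (\<Sum>n. (cmod (ip f (k n)))\<^sup>2) \<and>
    (\<Sum>n. (cmod (ip f (k n)))\<^sup>2) \<le> B * (nrm f)\<^sup>2)"

text \<open>Pairing a convergent series with \<open>f\<close> shows that \<open>\<Sum> c n \<langle>k n, f\<rangle>\<close> converges for all \<open>c \<in> \<ell>\<^sup>2\<close>;
Landau's theorem makes the coefficients of \<open>f\<close> square summable.\<close>

lemma bessel_if_synthesis_converges: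
  assumes k: "\<And>n. k n \<in> V" and syn: "\<And>c. c \<in> ell2 \<Longrightarrow> \<exists>s. nrm_sums (\<lambda>n. c n \<odot> k n) s"
  shows "bessel k"
proof (rule bessel_if_square_summable[OF k])
  fix f assume f: "f \<in> V"
  have "(\<lambda>n. ip (k n) f) \<in> ell2"
  proof (rule landau_square_summable)
    fix c assume "c \<in> ell2"
    then obtain s where "nrm_sums (\<lambda>n. c n \<odot> k n) s" using syn by blast
    from nrm_sums_ip[OF this f] show "summable (\<lambda>n. c n * ip (k n) f)"
      using k f by (simp add: ip_scale_left sums_iff)
  qed
  moreover have "cmod (ip (k n) f) = cmod (ip f (k n))" for n
    using ip_commute[OF f k[of n]] by simp
  ultimately show "summable (\<lambda>n. (cmod (ip f (k n)))\<^sup>2)" by (simp add: ell2_iff)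
qed

text \<open>The lower bound comes from expanding \<open>L (M f)\<close>: its coefficient sequence has norm at most
\<open>C \<parallel>M f\<parallel>\<close>, and \<open>\<parallel>M f\<parallel>\<^sup>2 = \<langle>f, L (M f)\<rangle>\<close> is the pairing of that sequence with the coefficients of \<open>f\<close>.\<close>

lemma sampling_if_atomic:
  assumes adj: "adjoint_pair L M" and k: "\<And>n. k n \<in> V" and at: "atomic_system L k"
  shows "sampling_for M k"
proof -
  note adjD = adjoint_pairD[OF adj]
  have syn: "\<And>c. c \<in> ell2 \<Longrightarrow> \<exists>s. nrm_sums (\<lambda>n. c n \<odot> k n) s"
    using at by (simp add: atomic_system_def)
  have bes: "bessel k" by (rule bessel_if_synthesis_converges[OF k syn])
  obtain B where B: "B > 0" "\<And>f. f \<in> V \<Longrightarrow> (\<lambda>n. ip f (k n)) \<in> ell2"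
    "\<And>f. f \<in> V \<Longrightarrow> ell2_norm (\<lambda>n. ip f (k n)) \<le> B * nrm f"
    using besselE[OF bes] by metis
  obtain C where C: "C > 0"
    "\<And>f. f \<in> V \<Longrightarrow> \<exists>a\<in>ell2. ell2_norm a \<le> C * nrm f \<and> nrm_sums (\<lambda>n. a n \<odot> k n) (L f)"
    using at unfolding atomic_system_def by metis
  have lower: "nrm (M f) \<le> C * ell2_norm (\<lambda>n. ip f (k n))" if f: "f \<in> V" for f
  proof -
    let ?T = "\<lambda>n. ip f (k n)"
    obtain a where a: "a \<in> ell2" "ell2_norm a \<le> C * nrm (M f)" "nrm_sums (\<lambda>n. a n \<odot> k n) (L (M f))"
      using C(2)[OF adjD(2)[OF f]] by blast
    have "(\<lambda>n. ?T n * cnj (a n)) sums ip f (L (M f))"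
      using nrm_sums_iff_bessel_expansion[OF bes a(1)] a(3) f adjD by blast
    moreover have "ip f (L (M f)) = ip (M f) (M f)"
      using adjoint_pairD(3)[OF adjoint_pair_commute[OF adj]] f adjD(2) by metis
    ultimately have "ell2_ip ?T a = of_real ((nrm (M f))\<^sup>2)"
      using ip_self[OF adjD(2)[OF f]] by (simp add: ell2_ip_def sums_iff)
    then have "(nrm (M f))\<^sup>2 \<le> ell2_norm ?T * ell2_norm a"
      using ell2.Cauchy_Schwarz[OF B(2)[OF f] a(1)] B(2)[OF f] a(1) by (simp add: ell2_norm_eq norm_power)
    also have "\<dots> \<le> ell2_norm ?T * (C * nrm (M f))"
      using a(2) B(2)[OF f] by (intro mult_left_mono) (auto simp: ell2_norm_eq)
    finally have sq: "nrm (M f) * nrm (M f) \<le> C * ell2_norm ?T * nrm (M f)"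
      by (simp add: power2_eq_square mult_ac)
    have T0: "0 \<le> ell2_norm ?T" using B(2)[OF f] by (simp add: ell2_norm_eq)
    show ?thesis
    proof (cases "nrm (M f) = 0")
      case True
      then show ?thesis using C(1) T0 by simp
    next
      case False
      then have "nrm (M f) > 0" using nrm_nonneg[OF adjD(2)[OF f]] by linarith
      with sq show ?thesis by simp
    qed
  qed
  have "1 / C\<^sup>2 * (nrm (M f))\<^sup>2 \<le> (\<Sum>n. (cmod (ip f (k n)))\<^sup>2)" if f: "f \<in> V" for f
  proof -
    have "(nrm (M f))\<^sup>2 \<le> (C * ell2_norm (\<lambda>n. ip f (k n)))\<^sup>2"
      using lower[OF f] adjD(2)[OF f] by (intro power_mono) auto
    then show ?thesis
      using C(1) by (simp add: power_mult_distrib ell2_norm_sq[OF B(2)[OF f]] field_simps)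
  qed
  moreover have "(\<Sum>n. (cmod (ip f (k n)))\<^sup>2) \<le> B\<^sup>2 * (nrm f)\<^sup>2" if f: "f \<in> V" for f
    unfolding ell2_norm_sq[OF B(2)[OF f], symmetric] power_mult_distrib[symmetric]
    using B(3)[OF f] B(2)[OF f] by (intro power_mono) (auto simp: ell2_norm_eq)
  moreover have "1 / C\<^sup>2 > 0" "B\<^sup>2 > 0" using B(1) C(1) by auto
  ultimately show ?thesis
    unfolding sampling_for_def using B(2) unfolding ell2_iff by blast
qed

lemma expansion_if_sampling:
  assumes adj: "adjoint_pair L M" and k: "\<And>n. k n \<in> V" and samp: "sampling_for M k"
  shows "bessel k" "\<exists>g. bessel g \<and> (\<forall>f\<in>V. nrm_sums (\<lambda>n. ip f (g n) \<odot> k n) (L f))"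
proof -
  note adjD = adjoint_pairD[OF adj]
  obtain A where A: "A > 0" "\<And>f. f \<in> V \<Longrightarrow> summable (\<lambda>n. (cmod (ip f (k n)))\<^sup>2)"
    "\<And>f. f \<in> V \<Longrightarrow> A * (nrm (M f))\<^sup>2 \<le> (\<Sum>n. (cmod (ip f (k n)))\<^sup>2)"
    using samp unfolding sampling_for_def by metis
  show bes: "bessel k" by (rule bessel_if_square_summable[OF k A(2)])
  have "nrm (M f) \<le> (1 / sqrt A) * ell2_norm (\<lambda>n. ip f (k n))" if f: "f \<in> V" for f
  proof -
    have "sqrt A * nrm (M f) \<le> ell2_norm (\<lambda>n. ip f (k n))"
      using real_sqrt_le_mono[OF A(3)[OF f]] adjD(2)[OF f] by (simp add: real_sqrt_mult ell2_norm_def)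
    then show ?thesis using A(1) by (simp add: field_simps)
  qed
  then obtain g where g: "bessel g"
    "\<And>f h. f \<in> V \<Longrightarrow> h \<in> V \<Longrightarrow> (\<lambda>n. ip h (k n) * cnj (ip f (g n))) sums ip (M h) f"
    using bounded_by_bessel_coefficients_factors[OF bes adjD(2) adjoint_pair_add[OF adj]
        adjoint_pair_scale[OF adj], of "1 / sqrt A"] A(1) by auto
  have "nrm_sums (\<lambda>n. ip f (g n) \<odot> k n) (L f)" if f: "f \<in> V" for f
    unfolding nrm_sums_iff_bessel_expansion[OF bes bessel_coefficients_in_ell2[OF g(1) f] adjD(1)[OF f]]
    using g(2)[OF f] adjoint_pairD(3)[OF adjoint_pair_commute[OF adj]] f by metis
  with g(1) show "\<exists>g. bessel g \<and> (\<forall>f\<in>V. nrm_sums (\<lambda>n. ip f (g n) \<odot> k n) (L f))" by blast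
qed

lemma atomic_if_expansion:
  assumes k: "bessel k" and g: "bessel g"
    and exp: "\<forall>f\<in>V. nrm_sums (\<lambda>n. ip f (g n) \<odot> k n) (L f)"
  shows "atomic_system L k"
proof -
  obtain B where B: "B > 0" "\<And>f. f \<in> V \<Longrightarrow> (\<lambda>n. ip f (g n)) \<in> ell2"
    "\<And>f. f \<in> V \<Longrightarrow> ell2_norm (\<lambda>n. ip f (g n)) \<le> B * nrm f"
    using besselE[OF g] by metis
  show ?thesis
    unfolding atomic_system_def using bessel_synthesis[OF k] B exp by metis
qed

theorem atomic_system_characterizations:
  assumes adj: "adjoint_pair L M" and k: "\<And>n. k n \<in> V"
  shows "atomic_system L k \<longleftrightarrow> sampling_for M k"
    and "sampling_for M k \<longleftrightarrow>
      bessel k \<and> (\<exists>g. bessel g \<and> (\<forall>f\<in>V. nrm_sums (\<lambda>n. ip f (g n) \<odot> k n) (L f)))"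
    and "sampling_for M k \<longleftrightarrow>
      (\<forall>f\<in>V. summable (\<lambda>n. (cmod (ip f (k n)))\<^sup>2)) \<and>
      (\<exists>g. bessel g \<and> (\<forall>f\<in>V. nrm_sums (\<lambda>n. ip f (k n) \<odot> g n) (M f)))"
proof -
  let ?III = "bessel k \<and> (\<exists>g. bessel g \<and> (\<forall>f\<in>V. nrm_sums (\<lambda>n. ip f (g n) \<odot> k n) (L f)))"
  let ?IV = "(\<forall>f\<in>V. summable (\<lambda>n. (cmod (ip f (k n)))\<^sup>2)) \<and>
      (\<exists>g. bessel g \<and> (\<forall>f\<in>V. nrm_sums (\<lambda>n. ip f (k n) \<odot> g n) (M f)))"
  have 12: "atomic_system L k \<Longrightarrow> sampling_for M k" by (rule sampling_if_atomic[OF adj k])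
  have 23: "sampling_for M k \<Longrightarrow> ?III" using expansion_if_sampling[OF adj, of k] k by blast
  have 31: "?III \<Longrightarrow> atomic_system L k" using atomic_if_expansion by blast
  have bessel_iff: "bessel k \<longleftrightarrow> (\<forall>f\<in>V. summable (\<lambda>n. (cmod (ip f (k n)))\<^sup>2))"
    using bessel_if_square_summable[of k] k bessel_coefficients_in_ell2[of k] unfolding ell2_iff by metis
  have "(\<forall>f\<in>V. nrm_sums (\<lambda>n. ip f (g n) \<odot> k n) (L f)) \<longleftrightarrow>
      (\<forall>f\<in>V. nrm_sums (\<lambda>n. ip f (k n) \<odot> g n) (M f))" if "bessel k" "bessel g" for g
    using dual_bessel_expansion[OF adj that] dual_bessel_expansion[OF adjoint_pair_commute[OF adj] that(2,1)]
    by (rule iffI)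
  then have 34: "?III \<longleftrightarrow> ?IV"
    unfolding bessel_iff[symmetric] by (intro conj_cong ex_cong1 refl) 
  show "atomic_system L k \<longleftrightarrow> sampling_for M k" using 12 23 31 by blast
  show I: "sampling_for M k \<longleftrightarrow> ?III" using 12 23 31 by blast
  show "sampling_for M k \<longleftrightarrow> ?IV" using I 34 by (rule trans)
qed

end

section \<open>The Gaussian measure and its mean value property\<close>

lemma nn_integral_lborel_translate:
  fixes c :: "'a::euclidean_space"
  assumes "f \<in> borel_measurable borel"
  shows "(\<integral>\<^sup>+y. f (c + y) \<partial>lborel) = (\<integral>\<^sup>+y. f y \<partial>lborel)"
proof -
  have "(\<integral>\<^sup>+y. f y \<partial>lborel) = (\<integral>\<^sup>+y. f y \<partial>distr lborel borel ((+) c))"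
    by (simp add: lborel_distr_plus)
  also have "\<dots> = (\<integral>\<^sup>+y. f (c + y) \<partial>lborel)"
    using assms by (subst nn_integral_distr) auto
  finally show ?thesis by simp
qed

text \<open>This is the uniqueness argument for Haar measure. Let \<open>B\<close> be the unit ball. By Fubini and translation
invariance, \<open>\<integral> \<integral> 1\<^sub>B(x) 1\<^sub>A(f y + x) dy dx\<close> equals both \<open>\<bar>B\<bar> \<bar>f\<^sup>-\<^sup>1 A\<bar>\<close> and \<open>\<bar>f\<^sup>-\<^sup>1 B\<bar> \<bar>A\<bar>\<close>; since \<open>f\<close> preserves norms,
\<open>f\<^sup>-\<^sup>1 B = B\<close>, and the positive finite factor \<open>\<bar>B\<bar>\<close> cancels.\<close>

theorem lborel_distr_orthogonal_transformation:
  fixes f :: "'a::euclidean_space \<Rightarrow> 'a"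
  assumes f: "orthogonal_transformation f"
  shows "distr lborel borel f = lborel"
proof (rule measure_eqI)
  have lin: "linear f" and norm_f: "\<And>x. norm (f x) = norm x"
    using f by (auto simp: orthogonal_transformation)
  have meas [measurable]: "f \<in> borel_measurable borel"
    by (intro borel_measurable_continuous_onI linear_continuous_on linear_conv_bounded_linear[THEN iffD1] lin)
  obtain g where g: "\<And>x. f (g x) = x"
    using orthogonal_transformation_surj[OF f] by (metis surjD)
  fix A assume "A \<in> sets (distr lborel borel f)"
  then have A [measurable]: "A \<in> sets borel" by simp
  define B where "B = ball (0::'a) 1"
  have B [measurable]: "B \<in> sets borel" by (simp add: B_def)
  have B_sym: "indicator B (x - y) = (indicator B (y - x) :: ennreal)" for x y
    by (simp add: B_def indicator_def norm_minus_commute)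
  have shift: "(\<integral>\<^sup>+y. \<phi> (f y + x) \<partial>lborel) = (\<integral>\<^sup>+y. \<phi> (f y) \<partial>lborel)"
    if [measurable]: "\<phi> \<in> borel_measurable borel" for \<phi> :: "'a \<Rightarrow> ennreal" and x
    using nn_integral_lborel_translate[of "\<lambda>y. \<phi> (f y)" "g x"]
    by (simp add: linear_add[OF lin] g add.commute)
  have "(\<integral>\<^sup>+x. indicator B x \<partial>lborel) * (\<integral>\<^sup>+y. indicator A (f y) \<partial>lborel) =
      (\<integral>\<^sup>+x. (indicator B x * (\<integral>\<^sup>+y. indicator A (f y + x) \<partial>lborel)) \<partial>lborel)"
    by (simp add: shift nn_integral_multc)
  also have "\<dots> = (\<integral>\<^sup>+x. (\<integral>\<^sup>+y. indicator B x * indicator A (f y + x) \<partial>lborel) \<partial>lborel)"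
    by (simp add: nn_integral_cmult)
  also have "\<dots> = (\<integral>\<^sup>+y. (\<integral>\<^sup>+x. indicator B x * indicator A (f y + x) \<partial>lborel) \<partial>lborel)"
    by (rule lborel_pair.Fubini'[symmetric]) measurable
  also have "\<dots> = (\<integral>\<^sup>+y. (\<integral>\<^sup>+x. indicator B (x - f y) * indicator A x \<partial>lborel) \<partial>lborel)"
  proof (rule nn_integral_cong)
    fix y
    show "(\<integral>\<^sup>+x. indicator B x * indicator A (f y + x) \<partial>lborel) = (\<integral>\<^sup>+x. indicator B (x - f y) * (indicator A x :: ennreal) \<partial>lborel)"
      using nn_integral_lborel_translate[of "\<lambda>x. indicator B (x - f y) * indicator A x" "f y"] by simp
  qed
  also have "\<dots> = (\<integral>\<^sup>+x. (\<integral>\<^sup>+y. indicator B (x - f y) * indicator A x \<partial>lborel) \<partial>lborel)"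
    by (rule lborel_pair.Fubini') measurable
  also have "\<dots> = (\<integral>\<^sup>+x. (\<integral>\<^sup>+y. indicator B (f y) \<partial>lborel) * indicator A x \<partial>lborel)"
  proof (rule nn_integral_cong)
    fix x
    show "(\<integral>\<^sup>+y. indicator B (x - f y) * indicator A x \<partial>lborel) = (\<integral>\<^sup>+y. indicator B (f y) \<partial>lborel) * (indicator A x :: ennreal)"
      using shift[of "indicator B" "- x"] unfolding B_sym[of x] by (simp add: nn_integral_multc)
  qed
  also have "\<dots> = emeasure lborel B * emeasure lborel A"
  proof -
    have "indicator B (f y) = (indicator B y :: ennreal)" for y
      by (simp add: B_def indicator_def norm_f)
    then show ?thesis by (simp add: nn_integral_cmult)
  qed
  finally have "emeasure lborel B * (\<integral>\<^sup>+y. indicator A (f y) \<partial>lborel) = emeasure lborel B * emeasure lborel A"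
    by simp
  moreover have "(\<integral>\<^sup>+y. indicator A (f y) \<partial>lborel) = emeasure (distr lborel borel f) A"
    using nn_integral_distr[of f lborel borel "indicator A"] by simp
  moreover have "emeasure lborel B \<noteq> 0" "emeasure lborel B \<noteq> \<infinity>"
    using emeasure_lborel_ball_finite[of "0::'a" 1] content_ball_pos[of 1 "0::'a"]
    by (auto simp: B_def measure_def)
  ultimately show "emeasure (distr lborel borel f) A = emeasure lborel A"
    by (simp add: ennreal_mult_cancel_left)
qed simp

definition gauss_weight :: "real \<Rightarrow> complex \<Rightarrow> real" where
  "gauss_weight \<alpha> z = \<alpha> / pi * exp (- \<alpha> * (cmod z)\<^sup>2)"

lemma fock_measure_eq: "fock_measure \<alpha> = density lborel (\<lambda>z. ennreal (gauss_weight \<alpha> z))"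
  by (simp add: fock_measure_def gauss_weight_def)

lemma gauss_weight_measurable [measurable]: "gauss_weight \<alpha> \<in> borel_measurable borel"
  unfolding gauss_weight_def[abs_def] by measurable

lemma gauss_weight_nonneg: "\<alpha> > 0 \<Longrightarrow> 0 \<le> gauss_weight \<alpha> z"
  by (simp add: gauss_weight_def)

lemma sets_fock_measure [simp, measurable_cong]: "sets (fock_measure \<alpha>) = sets borel"
  by (simp add: fock_measure_def)

lemma space_fock_measure [simp]: "space (fock_measure \<alpha>) = UNIV"
  by (simp add: fock_measure_def)

text \<open>The weight is the product of two normal densities of variance \<open>1 / (2 \<alpha>)\<close>, one in each
coordinate.\<close>

lemma prob_space_fock_measure:
  assumes "\<alpha> > 0"
  shows "prob_space (fock_measure \<alpha>)"
proof
  define \<sigma> where "\<sigma> = 1 / sqrt (2 * \<alpha>)"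
  have \<sigma>: "\<sigma> > 0" "2 * \<sigma>\<^sup>2 = 1 / \<alpha>" using assms by (auto simp: \<sigma>_def power_divide)
  have dens: "normal_density 0 \<sigma> x = sqrt (\<alpha> / pi) * exp (- \<alpha> * x\<^sup>2)" for x
  proof -
    have "2 * pi * \<sigma>\<^sup>2 = pi / \<alpha>" using \<sigma>(2) by (metis mult.assoc mult.commute times_divide_eq_right mult_1_right)
    then show ?thesis
      using assms unfolding normal_density_def \<sigma>(2) by (simp add: real_sqrt_divide mult.commute)
  qed
  have prod: "(\<Prod>b\<in>Basis. ennreal (normal_density 0 \<sigma> (z \<bullet> b))) = ennreal (gauss_weight \<alpha> z)" for z :: complex
  proof -
    have "gauss_weight \<alpha> z = normal_density 0 \<sigma> (Re z) * normal_density 0 \<sigma> (Im z)"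
    proof -
      have "sqrt (\<alpha> / pi) * exp (- \<alpha> * (Re z)\<^sup>2) * (sqrt (\<alpha> / pi) * exp (- \<alpha> * (Im z)\<^sup>2))
          = (sqrt (\<alpha> / pi))\<^sup>2 * exp (- \<alpha> * (Re z)\<^sup>2 + - \<alpha> * (Im z)\<^sup>2)"
        by (simp only: exp_add power2_eq_square mult_ac)
      also have "\<dots> = gauss_weight \<alpha> z"
        using assms by (simp add: gauss_weight_def cmod_power2 algebra_simps)
      finally show ?thesis by (simp only: dens)
    qed
    then show ?thesis
      by (simp add: Basis_complex_def ennreal_mult inner_complex_def)
  qed
  have "emeasure (fock_measure \<alpha>) (space (fock_measure \<alpha>)) = (\<integral>\<^sup>+z. ennreal (gauss_weight \<alpha> z) \<partial>lborel)"
    by (simp add: fock_measure_eq emeasure_density)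
  also have "\<dots> = (\<integral>\<^sup>+z. (\<Prod>b\<in>(Basis::complex set). ennreal (normal_density 0 \<sigma> (z \<bullet> b))) \<partial>lborel)"
    by (simp only: prod)
  also have "\<dots> = (\<Prod>b\<in>(Basis::complex set). (\<integral>\<^sup>+x. ennreal (normal_density 0 \<sigma> x) \<partial>lborel))"
    by (rule nn_integral_lborel_prod) auto
  also have "(\<integral>\<^sup>+x. ennreal (normal_density 0 \<sigma> x) \<partial>lborel) = 1"
    using \<sigma>(1) by (subst nn_integral_eq_integral) auto
  finally show "emeasure (fock_measure \<alpha>) (space (fock_measure \<alpha>)) = 1" by simp
qed

lemma fock_measure_rotation_invariant:
  assumes c: "cmod c = 1"
  shows "distr (fock_measure \<alpha>) borel (\<lambda>z. c * z) = fock_measure \<alpha>"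
proof (rule measure_eqI)
  have rot: "distr lborel borel (\<lambda>z. c * z) = lborel"
    by (rule lborel_distr_orthogonal_transformation)
       (use c in \<open>auto simp: orthogonal_transformation norm_mult intro: bounded_linear.linear bounded_linear_mult_right\<close>)
  fix A assume "A \<in> sets (distr (fock_measure \<alpha>) borel (\<lambda>z. c * z))"
  then have A [measurable]: "A \<in> sets borel" by simp
  have w: "gauss_weight \<alpha> (c * z) = gauss_weight \<alpha> z" for z
    using c by (simp add: gauss_weight_def norm_mult)
  have "emeasure (distr (fock_measure \<alpha>) borel (\<lambda>z. c * z)) A = emeasure (fock_measure \<alpha>) ((\<lambda>z. c * z) -` A)"
    by (subst emeasure_distr) auto
  also have "\<dots> = (\<integral>\<^sup>+z. ennreal (gauss_weight \<alpha> (c * z)) * indicator A (c * z) \<partial>lborel)"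
  proof -
    have "(\<lambda>z. c * z) -` A \<in> sets borel"
      using measurable_sets[of "\<lambda>z. c * z" borel borel A] by simp
    then show ?thesis
      unfolding fock_measure_eq
      by (subst emeasure_density) (auto simp: w indicator_def intro!: nn_integral_cong)
  qed
  also have "\<dots> = (\<integral>\<^sup>+z. ennreal (gauss_weight \<alpha> z) * indicator A z \<partial>distr lborel borel (\<lambda>z. c * z))"
    by (subst nn_integral_distr) auto
  also have "\<dots> = emeasure (fock_measure \<alpha>) A"
    unfolding rot fock_measure_eq by (subst emeasure_density) auto
  finally show "emeasure (distr (fock_measure \<alpha>) borel (\<lambda>z. c * z)) A = emeasure (fock_measure \<alpha>) A" .
qed simp

lemma entire_measurable: "f holomorphic_on UNIV \<Longrightarrow> f \<in> borel_measurable borel"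
  by (intro borel_measurable_continuous_onI holomorphic_on_imp_continuous_on)

text \<open>Cauchy's formula at \<open>0\<close> on the unit circle, for the entire function \<open>u \<mapsto> h (u z)\<close>.\<close>

lemma circle_average:
  assumes h: "h holomorphic_on UNIV"
  shows "(LINT t|restrict_space lborel {0..1}. h (exp (2 * of_real pi * \<i> * of_real t) * z)) = h 0"
proof -
  have hz: "(\<lambda>u. h (u * z)) holomorphic_on UNIV"
    using holomorphic_on_compose_gen[of "\<lambda>u. u * z" UNIV h UNIV] h
    by (simp add: comp_def holomorphic_intros)
  let ?g = "\<lambda>t::real. h (exp (2 * of_real pi * \<i> * of_real t) * z)"
  define c :: complex where "c = 2 * of_real pi * \<i>"
  have c_nonzero: "c \<noteq> 0" by (simp add: c_def)
  have cancel: "inverse c * (c * v) = v" for v using c_nonzero by simp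
  have "((\<lambda>u. h (u * z) / (u - 0)) has_contour_integral (c * h (0 * z))) (circlepath 0 1)"
    unfolding c_def
    by (rule Cauchy_integral_circlepath_simple) (use hz in \<open>auto intro: holomorphic_on_subset\<close>)
  then have "((\<lambda>t. c * ?g t) has_integral c * h 0) {0..1}"
    unfolding has_contour_integral vector_derivative_circlepath
    by (simp add: circlepath mult_ac c_def)
  then have hi: "(?g has_integral h 0) {0..1}"
    using has_integral_mult_right[of "\<lambda>t. c * ?g t" "c * h 0" "{0..1}" "inverse c"]
    unfolding cancel by blast
  have cont: "continuous_on UNIV ?g"
    by (rule continuous_on_compose2[OF holomorphic_on_imp_continuous_on[OF h]])
       (auto intro!: continuous_on_mult continuous_on_exp continuous_on_of_real continuous_on_const continuous_on_id)
  have "set_integrable lborel {0..1} ?g"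
    unfolding set_integrable_def
    by (rule borel_integrable_compact) (auto intro: continuous_on_subset[OF cont])
  then have "(LINT t:{0..1}|lborel. ?g t) = integral {0..1} ?g"
    by (rule set_borel_integral_eq_integral)
  also have "\<dots> = h 0" using hi by (rule integral_unique)
  finally show ?thesis
    by (simp add: integral_restrict_space set_lebesgue_integral_def)
qed

text \<open>Rotation invariance allows \<open>h\<close> to be replaced by its average over rotations, which is the constant
\<open>h 0\<close> by Cauchy's formula. Averaging over the rotation group takes the place of polar coordinates.\<close>

theorem fock_measure_mean_value:
  assumes \<alpha>: "\<alpha> > 0" and h: "h holomorphic_on UNIV" and int: "integrable (fock_measure \<alpha>) h"
  shows "integral\<^sup>L (fock_measure \<alpha>) h = h 0"
proof -
  let ?\<gamma> = "fock_measure \<alpha>"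
  let ?N = "restrict_space lborel {0..1::real}"
  let ?e = "\<lambda>t::real. exp (2 * of_real pi * \<i> * of_real t) :: complex"
  interpret \<gamma>: prob_space ?\<gamma> using \<alpha> by (rule prob_space_fock_measure)
  interpret N: prob_space ?N
    by (rule prob_spaceI) (simp add: emeasure_restrict_space space_restrict_space)
  interpret pair_sigma_finite ?N ?\<gamma> ..
  have h_meas [measurable]: "h \<in> borel_measurable borel" using h by (rule entire_measurable)
  have e_meas [measurable]: "?e \<in> borel_measurable borel"
    by (intro borel_measurable_continuous_onI continuous_intros)
  have e_N [measurable]: "?e \<in> borel_measurable ?N"
    by (rule measurable_restrict_space1) simp
  have cmod_e: "cmod (?e t) = 1" for t by (simp add: norm_exp_eq_Re)
  have rot: "distr ?\<gamma> borel (\<lambda>z. ?e t * z) = ?\<gamma>" for t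
    by (rule fock_measure_rotation_invariant) (rule cmod_e)
  have int_rot: "(LINT z|?\<gamma>. F (?e t * z)) = integral\<^sup>L ?\<gamma> F"
    if "F \<in> borel_measurable borel" for F :: "complex \<Rightarrow> 'c::{banach, second_countable_topology}" and t
    using integral_distr[of "\<lambda>z. ?e t * z" ?\<gamma> borel F] that unfolding rot by simp
  have intble_rot: "integrable ?\<gamma> (\<lambda>z. h (?e t * z))" for t
    using integrable_distr[of "\<lambda>z. ?e t * z" ?\<gamma> borel h] int unfolding rot by simp
  have pair: "integrable (?N \<Otimes>\<^sub>M ?\<gamma>) (\<lambda>(t, z). h (?e t * z))"
  proof (rule Fubini_integrable)
    show "(\<lambda>(t, z). h (?e t * z)) \<in> borel_measurable (?N \<Otimes>\<^sub>M ?\<gamma>)" by measurable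
    show "integrable ?N (\<lambda>t. LINT z|?\<gamma>. norm (case (t, z) of (t, z) \<Rightarrow> h (?e t * z)))"
      using int_rot[of "\<lambda>z. norm (h z)"] by simp
  qed (use intble_rot in simp)
  have "h 0 = (LINT z|?\<gamma>. h 0)" using \<gamma>.prob_space by simp
  also have "\<dots> = (LINT z|?\<gamma>. (LINT t|?N. h (?e t * z)))"
    by (simp only: circle_average[OF h])
  also have "\<dots> = (LINT t|?N. (LINT z|?\<gamma>. h (?e t * z)))"
    by (rule Fubini_integral[OF pair])
  also have "\<dots> = (LINT t|?N. integral\<^sup>L ?\<gamma> h)"
    by (simp only: int_rot[OF h_meas])
  also have "\<dots> = integral\<^sup>L ?\<gamma> h" using N.prob_space by simp
  finally show ?thesis ..
qed

lemma integrable_fock_measure_iff: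
  fixes f :: "complex \<Rightarrow> 'b::{banach, second_countable_topology}"
  assumes "\<alpha> > 0" "f \<in> borel_measurable borel"
  shows "integrable (fock_measure \<alpha>) f \<longleftrightarrow> integrable lborel (\<lambda>z. gauss_weight \<alpha> z *\<^sub>R f z)"
  unfolding fock_measure_eq using assms
  by (subst integrable_density) (auto simp: gauss_weight_nonneg)

lemma integral_fock_measure:
  fixes f :: "complex \<Rightarrow> 'b::{banach, second_countable_topology}"
  assumes "\<alpha> > 0" "f \<in> borel_measurable borel"
  shows "integral\<^sup>L (fock_measure \<alpha>) f = (LINT z|lborel. gauss_weight \<alpha> z *\<^sub>R f z)"
  unfolding fock_measure_eq using assms
  by (subst integral_density) (auto simp: gauss_weight_nonneg)

lemma integrable_lborel_translate:
  fixes f :: "'a::euclidean_space \<Rightarrow> 'b::{banach, second_countable_topology}"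
  assumes "f \<in> borel_measurable borel"
  shows "integrable lborel (\<lambda>x. f (c + x)) \<longleftrightarrow> integrable lborel f"
  using integrable_distr_eq[of "(+) c" lborel borel f] assms by (simp add: lborel_distr_plus)

lemma integral_lborel_translate:
  fixes f :: "'a::euclidean_space \<Rightarrow> 'b::{banach, second_countable_topology}"
  assumes "f \<in> borel_measurable borel"
  shows "(LINT x|lborel. f (c + x)) = (LINT x|lborel. f x)"
  using integral_distr[of "(+) c" lborel borel f] assms by (simp add: lborel_distr_plus)

lemma normalized_kernel_holomorphic: "fock_normalized_kernel \<alpha> w holomorphic_on UNIV"
  unfolding fock_normalized_kernel_def[abs_def] by (intro holomorphic_intros)

text \<open>Completing the square, \<open>\<bar>k\<^sub>w(z)\<bar>\<^sup>2\<close> times the Gaussian weight at \<open>z\<close> is the weight at \<open>z - w\<close>.\<close>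

lemma normalized_kernel_in_fock_space:
  assumes \<alpha>: "\<alpha> > 0"
  shows "fock_normalized_kernel \<alpha> w \<in> fock_space \<alpha>"
proof -
  have meas: "fock_normalized_kernel \<alpha> w \<in> borel_measurable borel"
    by (rule entire_measurable[OF normalized_kernel_holomorphic])
  have "gauss_weight \<alpha> z * (cmod (fock_normalized_kernel \<alpha> w z))\<^sup>2 = gauss_weight \<alpha> (- w + z)" for z
  proof -
    have "- \<alpha> * (cmod z)\<^sup>2 + 2 * (\<alpha> * (Re (z * cnj w) - (cmod w)\<^sup>2 / 2)) = - \<alpha> * (cmod (- w + z))\<^sup>2"
      unfolding cmod_power2 by (simp add: power2_eq_square algebra_simps)
    then have "exp (- \<alpha> * (cmod z)\<^sup>2) * exp (2 * (\<alpha> * (Re (z * cnj w) - (cmod w)\<^sup>2 / 2))) = exp (- \<alpha> * (cmod (- w + z))\<^sup>2)"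
      by (metis exp_add)
    moreover have "(cmod (fock_normalized_kernel \<alpha> w z))\<^sup>2 = exp (2 * (\<alpha> * (Re (z * cnj w) - (cmod w)\<^sup>2 / 2)))"
      unfolding fock_normalized_kernel_def norm_exp_eq_Re exp_double by (simp del: of_real_power)
    ultimately show ?thesis by (simp add: gauss_weight_def)
  qed
  moreover have "integrable lborel (gauss_weight \<alpha>)"
  proof -
    interpret prob_space "fock_measure \<alpha>" using \<alpha> by (rule prob_space_fock_measure)
    show ?thesis using integrable_fock_measure_iff[OF \<alpha>, of "\<lambda>z. 1::real"] by simp
  qed
  ultimately show ?thesis
    using meas \<alpha> normalized_kernel_holomorphic[of \<alpha> w]
    by (simp add: fock_space_def integrable_fock_measure_iff
        integrable_lborel_translate[of "gauss_weight \<alpha>" "- w", simplified])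
qed

lemma fock_space_measurable: "f \<in> fock_space \<alpha> \<Longrightarrow> f \<in> borel_measurable borel"
  by (simp add: fock_space_def entire_measurable)

lemma fock_inner_integrable:
  assumes f: "f \<in> fock_space \<alpha>" and g: "g \<in> fock_space \<alpha>"
  shows "integrable (fock_measure \<alpha>) (\<lambda>z. f z * cnj (g z))"
proof (rule Bochner_Integration.integrable_bound)
  show "integrable (fock_measure \<alpha>) (\<lambda>z. (cmod (f z))\<^sup>2 + (cmod (g z))\<^sup>2)"
    using f g by (auto simp: fock_space_def)
  have [measurable]: "f \<in> borel_measurable borel" "g \<in> borel_measurable borel"
    using f g fock_space_measurable by auto
  have [measurable]: "cnj \<in> borel_measurable borel"
    by (intro borel_measurable_continuous_onI continuous_intros)
  show "(\<lambda>z. f z * cnj (g z)) \<in> borel_measurable (fock_measure \<alpha>)" by measurable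
  have "norm (f z * cnj (g z)) \<le> norm ((cmod (f z))\<^sup>2 + (cmod (g z))\<^sup>2)" for z
  proof -
    have "cmod (f z) * cmod (g z) \<le> (cmod (f z))\<^sup>2 + (cmod (g z))\<^sup>2"
      using sum_squares_bound[of "cmod (f z)" "cmod (g z)"]
        mult_nonneg_nonneg[OF norm_ge_zero[of "f z"] norm_ge_zero[of "g z"]] by linarith
    then show ?thesis by (simp add: norm_mult)
  qed
  then show "AE z in fock_measure \<alpha>. norm (f z * cnj (g z)) \<le> norm ((cmod (f z))\<^sup>2 + (cmod (g z))\<^sup>2)"
    by simp
qed

text \<open>Translating the integral by \<open>w\<close> turns \<open>\<langle>f, k\<^sub>w\<rangle>\<close> into the Gaussian mean of an entire function \<open>h\<close>,
because the non-analytic factors of the kernel and of the shifted weight cancel. The mean value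
property then evaluates the integral at \<open>0\<close>.\<close>

theorem fock_reproducing:
  assumes \<alpha>: "\<alpha> > 0" and f: "f \<in> fock_space \<alpha>"
  shows "fock_inner \<alpha> f (fock_normalized_kernel \<alpha> w) = of_real (exp (- \<alpha> * ((cmod w)\<^sup>2 / 2))) * f w"
proof -
  let ?k = "fock_normalized_kernel \<alpha> w"
  define h where "h u = f (w + u) * exp (- of_real \<alpha> * (u * cnj w + of_real ((cmod w)\<^sup>2 / 2)))" for u
  have f_hol: "f holomorphic_on UNIV" using f by (simp add: fock_space_def)
  have "(\<lambda>u. f (w + u)) holomorphic_on UNIV"
    using holomorphic_on_compose_gen[of "\<lambda>u. w + u" UNIV f UNIV] f_hol
    by (simp add: comp_def holomorphic_intros)
  then have h_hol: "h holomorphic_on UNIV"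
    unfolding h_def[abs_def] by (intro holomorphic_intros)
  have k: "?k \<in> fock_space \<alpha>" using \<alpha> by (rule normalized_kernel_in_fock_space)
  have [measurable]: "f \<in> borel_measurable borel" "?k \<in> borel_measurable borel" "h \<in> borel_measurable borel"
    using f k fock_space_measurable entire_measurable[OF h_hol] by auto
  have [measurable]: "cnj \<in> borel_measurable borel"
    by (intro borel_measurable_continuous_onI continuous_intros)
  define F where "F z = gauss_weight \<alpha> z *\<^sub>R (f z * cnj (?k z))" for z
  have F_meas [measurable]: "F \<in> borel_measurable borel" unfolding F_def[abs_def] by measurable
  have F_shift: "F (w + u) = gauss_weight \<alpha> u *\<^sub>R h u" for u
  proof -
    have e: "- of_real \<alpha> * ((w + u) * cnj (w + u)) + of_real \<alpha> * (cnj (w + u) * w - of_real ((cmod w)\<^sup>2 / 2))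
       = - of_real \<alpha> * (u * cnj u) + (- of_real \<alpha> * (u * cnj w + of_real ((cmod w)\<^sup>2 / 2)))"
    proof -
      have "of_real ((cmod w)\<^sup>2 / 2) = w * cnj w / 2"
        by (simp add: complex_norm_square[symmetric] del: of_real_power)
      then show ?thesis by (simp add: algebra_simps)
    qed
    have ex: "of_real (exp (- \<alpha> * (cmod v)\<^sup>2)) = exp (- of_real \<alpha> * (v * cnj v))" for v
      by (simp add: exp_of_real[symmetric] complex_norm_square[symmetric] del: of_real_power)
    have cj: "cnj (?k v) = exp (of_real \<alpha> * (cnj v * w - of_real ((cmod w)\<^sup>2 / 2)))" for v
      unfolding fock_normalized_kernel_def exp_cnj by simp
    have "of_real (exp (- \<alpha> * (cmod (w + u))\<^sup>2)) * cnj (?k (w + u)) =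
        of_real (exp (- \<alpha> * (cmod u)\<^sup>2)) * exp (- of_real \<alpha> * (u * cnj w + of_real ((cmod w)\<^sup>2 / 2)))"
      unfolding ex cj exp_add[symmetric] e ..
    then show ?thesis
      unfolding F_def h_def gauss_weight_def scaleR_conv_of_real of_real_mult by (simp add: mult_ac)
  qed
  have F_int: "integrable lborel F"
    using fock_inner_integrable[OF f k] \<alpha> unfolding F_def[abs_def]
    by (subst (asm) integrable_fock_measure_iff) auto
  have h_int: "integrable (fock_measure \<alpha>) h"
    using F_int integrable_lborel_translate[of F w] \<alpha>
    by (simp add: integrable_fock_measure_iff F_shift)
  have "fock_inner \<alpha> f ?k = (LINT z|lborel. F z)"
    unfolding fock_inner_def F_def using \<alpha> by (subst integral_fock_measure) auto
  also have "\<dots> = (LINT u|lborel. F (w + u))" by (rule integral_lborel_translate[symmetric]) measurable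
  also have "\<dots> = integral\<^sup>L (fock_measure \<alpha>) h"
    unfolding F_shift using \<alpha> by (subst integral_fock_measure) auto
  also have "\<dots> = h 0" by (rule fock_measure_mean_value[OF \<alpha> h_hol h_int])
  also have "\<dots> = of_real (exp (- \<alpha> * ((cmod w)\<^sup>2 / 2))) * f w"
    by (simp add: h_def exp_of_real[symmetric] mult.commute)
  finally show ?thesis .
qed

section \<open>The Fock space as a Hilbert space\<close>

lemma fock_inner_self: "fock_inner \<alpha> f f = of_real (LINT z|fock_measure \<alpha>. (cmod (f z))\<^sup>2)"
proof -
  have "fock_inner \<alpha> f f = (LINT z|fock_measure \<alpha>. of_real ((cmod (f z))\<^sup>2))"
    unfolding fock_inner_def complex_norm_square ..
  then show ?thesis by (simp only: integral_complex_of_real)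
qed

lemma fock_semi_inner_space:
  "semi_inner_space (\<lambda>c f z. c * f z) (fock_space \<alpha>) (fock_inner \<alpha>)"
proof -
  interpret vs: vector_space "\<lambda>c (f :: complex \<Rightarrow> complex) z. c * f z"
    by unfold_locales (auto simp: fun_eq_iff algebra_simps)
  show ?thesis
  proof
    show "vs.subspace (fock_space \<alpha>)"
      unfolding vs.subspace_def
    proof (intro conjI ballI allI)
      show "0 \<in> fock_space \<alpha>" by (simp add: fock_space_def zero_fun_def)
      fix f assume f: "f \<in> fock_space \<alpha>"
      show "(\<lambda>z. c * f z) \<in> fock_space \<alpha>" for c
        using f by (auto simp: fock_space_def norm_mult power_mult_distrib intro!: holomorphic_intros)
      fix g assume g: "g \<in> fock_space \<alpha>"
      have [measurable]: "f \<in> borel_measurable borel" "g \<in> borel_measurable borel"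
        using f g fock_space_measurable by auto
      have "integrable (fock_measure \<alpha>) (\<lambda>z. (cmod (f z + g z))\<^sup>2)"
      proof (rule Bochner_Integration.integrable_bound)
        show "integrable (fock_measure \<alpha>) (\<lambda>z. 2 * (cmod (f z))\<^sup>2 + 2 * (cmod (g z))\<^sup>2)"
          using f g by (auto simp: fock_space_def)
        show "(\<lambda>z. (cmod (f z + g z))\<^sup>2) \<in> borel_measurable (fock_measure \<alpha>)" by measurable
        show "AE z in fock_measure \<alpha>. norm ((cmod (f z + g z))\<^sup>2) \<le> norm (2 * (cmod (f z))\<^sup>2 + 2 * (cmod (g z))\<^sup>2)"
          using cmod_add_squared_le by simp
      qed
      then show "f + g \<in> fock_space \<alpha>"
        using f g by (auto simp: fock_space_def plus_fun_def intro!: holomorphic_intros)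
    qed
    fix f g h :: "complex \<Rightarrow> complex" and c
    show "fock_inner \<alpha> (f + g) h = fock_inner \<alpha> f h + fock_inner \<alpha> g h"
      if "f \<in> fock_space \<alpha>" "g \<in> fock_space \<alpha>" "h \<in> fock_space \<alpha>"
      using Bochner_Integration.integral_add[OF fock_inner_integrable[OF that(1,3)] fock_inner_integrable[OF that(2,3)]]
      by (simp add: fock_inner_def distrib_right)
    show "fock_inner \<alpha> (\<lambda>z. c * f z) h = c * fock_inner \<alpha> f h"
      by (simp add: fock_inner_def mult.assoc)
    show "fock_inner \<alpha> g f = cnj (fock_inner \<alpha> f g)"
    proof -
      have "cnj (fock_inner \<alpha> f g) = (LINT z|fock_measure \<alpha>. cnj (f z * cnj (g z)))"
        unfolding fock_inner_def by (rule Bochner_Integration.integral_cnj[symmetric])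
      then show ?thesis by (simp add: fock_inner_def mult.commute)
    qed
    show "0 \<le> Re (fock_inner \<alpha> f f)" by (simp add: fock_inner_self)
  qed
qed

text \<open>The integral of \<open>\<bar>f\<bar>\<^sup>2\<close> is real, so the real part in the abstract norm loses nothing.\<close>

lemma fock_norm_eq: "fock_norm \<alpha> = semi_inner_space.nrm (fock_inner \<alpha>)"
  by (simp add: semi_inner_space.nrm_def[OF fock_semi_inner_space] fock_norm_def fock_inner_self fun_eq_iff)

lemma fock_norm_sq: "(fock_norm \<alpha> f)\<^sup>2 = (LINT z|fock_measure \<alpha>. (cmod (f z))\<^sup>2)"
  by (simp add: fock_norm_def)

lemma normalized_kernel_norm:
  assumes \<alpha>: "\<alpha> > 0"
  shows "fock_norm \<alpha> (fock_normalized_kernel \<alpha> w) = 1"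
proof -
  have e: "exp (- \<alpha> * ((cmod w)\<^sup>2 / 2)) * exp (\<alpha> * ((cmod w)\<^sup>2 / 2)) = 1"
    by (simp add: exp_add[symmetric])
  have "w * cnj w - of_real ((cmod w)\<^sup>2 / 2) = of_real ((cmod w)\<^sup>2 / 2)"
    by (simp add: complex_norm_square[symmetric] del: of_real_power)
  then have "fock_normalized_kernel \<alpha> w w = of_real (exp (\<alpha> * ((cmod w)\<^sup>2 / 2)))"
    unfolding fock_normalized_kernel_def by (simp only: of_real_mult[symmetric] exp_of_real)
  then have "fock_inner \<alpha> (fock_normalized_kernel \<alpha> w) (fock_normalized_kernel \<alpha> w) = of_real 1"
    unfolding fock_reproducing[OF \<alpha> normalized_kernel_in_fock_space[OF \<alpha>]]
    by (simp only: of_real_mult[symmetric] e)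
  then show ?thesis
    by (simp add: fock_inner_self fock_norm_def)
qed

lemma fock_point_evaluation:
  assumes \<alpha>: "\<alpha> > 0" and f: "f \<in> fock_space \<alpha>"
  shows "cmod (f w) \<le> exp (\<alpha> * (cmod w)\<^sup>2 / 2) * fock_norm \<alpha> f"
proof -
  interpret semi_inner_space "\<lambda>c f z. c * f z" "fock_space \<alpha>" "fock_inner \<alpha>"
    by (rule fock_semi_inner_space)
  have "exp (- \<alpha> * ((cmod w)\<^sup>2 / 2)) * cmod (f w) \<le> fock_norm \<alpha> f"
    using Cauchy_Schwarz[OF f normalized_kernel_in_fock_space[OF \<alpha>, of w]]
    unfolding fock_reproducing[OF \<alpha> f] fock_norm_eq[symmetric] normalized_kernel_norm[OF \<alpha>]
    by (simp add: norm_mult)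
  then have "exp (\<alpha> * ((cmod w)\<^sup>2 / 2)) * (exp (- \<alpha> * ((cmod w)\<^sup>2 / 2)) * cmod (f w))
      \<le> exp (\<alpha> * ((cmod w)\<^sup>2 / 2)) * fock_norm \<alpha> f"
    by (intro mult_left_mono) auto
  then show ?thesis by (simp add: mult.assoc[symmetric] exp_add[symmetric])
qed

text \<open>Point evaluations are bounded uniformly on compact sets, so a Cauchy sequence converges locally
uniformly to an entire function; Fatou's lemma shows that the convergence holds in norm.\<close>

theorem fock_hilbert_space:
  assumes \<alpha>: "\<alpha> > 0"
  shows "hilbert_space (\<lambda>c f z. c * f z) (fock_space \<alpha>) (fock_inner \<alpha>)"
proof -
  interpret S: semi_inner_space "\<lambda>c f z. c * f z" "fock_space \<alpha>" "fock_inner \<alpha>"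
    by (rule fock_semi_inner_space)
  note nrm = fock_norm_eq[of \<alpha>, symmetric]
  show ?thesis
  proof
    show "f = 0" if f: "f \<in> fock_space \<alpha>" and 0: "fock_inner \<alpha> f f = 0" for f
    proof
      fix z
      have "fock_norm \<alpha> f = 0" using 0 by (simp add: fock_norm_def fock_inner_self)
      with fock_point_evaluation[OF \<alpha> f, of z] show "f z = 0 z" by simp
    qed
    fix X :: "nat \<Rightarrow> complex \<Rightarrow> complex"
    assume X: "\<And>n. X n \<in> fock_space \<alpha>" and cau: "S.nrm_Cauchy X"
    have D: "X m - X n \<in> fock_space \<alpha>" for m n by (intro S.diff_in X)
    have small: "\<exists>N. \<forall>m\<ge>N. \<forall>n\<ge>N. fock_norm \<alpha> (X m - X n) < e" if "e > 0" for e
      using cau that unfolding S.nrm_Cauchy_def nrm by blast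
    have pt: "cmod (X m z - X n z) \<le> exp (\<alpha> * R\<^sup>2 / 2) * fock_norm \<alpha> (X m - X n)"
      if "cmod z \<le> R" for m n z R
    proof -
      have "cmod (X m z - X n z) \<le> exp (\<alpha> * (cmod z)\<^sup>2 / 2) * fock_norm \<alpha> (X m - X n)"
        using fock_point_evaluation[OF \<alpha> D[of m n], of z] by simp
      also have "\<dots> \<le> exp (\<alpha> * R\<^sup>2 / 2) * fock_norm \<alpha> (X m - X n)"
        using \<alpha> that by (intro mult_right_mono) (auto simp: fock_norm_def intro!: power_mono)
      finally show ?thesis .
    qed
    have unif: "\<exists>N. \<forall>m\<ge>N. \<forall>n\<ge>N. \<forall>z. cmod z \<le> R \<longrightarrow> cmod (X m z - X n z) < e" if e: "e > 0" for e R
    proof -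
      obtain N where N: "\<And>m n. m \<ge> N \<Longrightarrow> n \<ge> N \<Longrightarrow> fock_norm \<alpha> (X m - X n) < e / exp (\<alpha> * R\<^sup>2 / 2)"
        using small[of "e / exp (\<alpha> * R\<^sup>2 / 2)"] e by auto
      have "cmod (X m z - X n z) < e" if "m \<ge> N" "n \<ge> N" "cmod z \<le> R" for m n z
      proof -
        have "exp (\<alpha> * R\<^sup>2 / 2) * fock_norm \<alpha> (X m - X n) < exp (\<alpha> * R\<^sup>2 / 2) * (e / exp (\<alpha> * R\<^sup>2 / 2))"
          using N[OF that(1,2)] by (intro mult_strict_left_mono) auto
        with pt[OF that(3), of m n] show ?thesis by simp
      qed
      then show ?thesis by blast
    qed
    have "\<exists>l. (\<lambda>n. X n z) \<longlonglongrightarrow> l" for z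
    proof -
      have "Cauchy (\<lambda>n. X n z)"
      proof (rule metric_CauchyI)
        fix e :: real assume "e > 0"
        from unif[OF this, of "cmod z"] show "\<exists>N. \<forall>m\<ge>N. \<forall>n\<ge>N. dist (X m z) (X n z) < e"
          unfolding dist_norm by blast
      qed
      then show ?thesis using Cauchy_convergent_iff convergent_def by blast
    qed
    then obtain F where F: "\<And>z. (\<lambda>n. X n z) \<longlonglongrightarrow> F z" by metis
    have X_hol: "X n holomorphic_on UNIV" for n using X[of n] by (simp add: fock_space_def)
    have F_hol: "F holomorphic_on UNIV"
    proof (rule holomorphic_uniform_sequence[OF open_UNIV X_hol])
      fix z :: complex
      have "uniform_limit (cball z 1) X F sequentially"
      proof (rule uniform_limitI)
        fix e :: real assume e: "e > 0"
        obtain N where N: "\<forall>m\<ge>N. \<forall>n\<ge>N. \<forall>u. cmod u \<le> cmod z + 1 \<longrightarrow> cmod (X m u - X n u) < e / 2"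
          using unif[of "e / 2" "cmod z + 1"] e by auto
        have "dist (X m u) (F u) < e" if m: "m \<ge> N" and u: "u \<in> cball z 1" for m u
        proof -
          have "cmod u \<le> cmod z + 1"
            using u norm_triangle_sub[of u z] by (simp add: dist_norm norm_minus_commute)
          then have "\<forall>n\<ge>N. cmod (X m u - X n u) \<le> e / 2" using N m by (simp add: less_imp_le)
          moreover have "(\<lambda>n. cmod (X m u - X n u)) \<longlonglongrightarrow> cmod (X m u - F u)"
            by (intro tendsto_intros F)
          ultimately have "cmod (X m u - F u) \<le> e / 2"
            by (intro LIMSEQ_le_const2) blast+
          then show ?thesis using e by (simp add: dist_norm)
        qed
        then show "\<forall>\<^sub>F m in sequentially. \<forall>u\<in>cball z 1. dist (X m u) (F u) < e"
          unfolding eventually_sequentially by blast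
      qed
      then show "\<exists>d>0. cball z d \<subseteq> UNIV \<and> uniform_limit (cball z d) X F sequentially"
        by (intro exI[of _ 1]) auto
    qed
    have X_meas [measurable]: "X n \<in> borel_measurable borel" for n
      using X fock_space_measurable by blast
    have F_meas [measurable]: "F \<in> borel_measurable borel" by (rule entire_measurable[OF F_hol])
    have near: "X m - F \<in> fock_space \<alpha> \<and> fock_norm \<alpha> (X m - F) \<le> e"
      if e: "e > 0" and N: "\<forall>m\<ge>N. \<forall>n\<ge>N. fock_norm \<alpha> (X m - X n) < e" and m: "m \<ge> N" for e N m
    proof -
      have "(\<integral>\<^sup>+z. ennreal ((cmod (X m z - F z))\<^sup>2) \<partial>fock_measure \<alpha>)
          = (\<integral>\<^sup>+z. liminf (\<lambda>n. ennreal ((cmod (X m z - X n z))\<^sup>2)) \<partial>fock_measure \<alpha>)"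
      proof (rule nn_integral_cong)
        fix z
        have "(\<lambda>n. ennreal ((cmod (X m z - X n z))\<^sup>2)) \<longlonglongrightarrow> ennreal ((cmod (X m z - F z))\<^sup>2)"
          by (intro tendsto_ennrealI tendsto_intros F)
        from lim_imp_Liminf[OF trivial_limit_sequentially this]
        show "ennreal ((cmod (X m z - F z))\<^sup>2) = liminf (\<lambda>n. ennreal ((cmod (X m z - X n z))\<^sup>2))"
          by (rule sym)
      qed
      also have "\<dots> \<le> liminf (\<lambda>n. \<integral>\<^sup>+z. ennreal ((cmod (X m z - X n z))\<^sup>2) \<partial>fock_measure \<alpha>)"
        by (rule nn_integral_liminf) measurable
      also have "\<dots> \<le> ennreal (e\<^sup>2)"
      proof -
        have "(\<integral>\<^sup>+z. ennreal ((cmod (X m z - X n z))\<^sup>2) \<partial>fock_measure \<alpha>) \<le> ennreal (e\<^sup>2)" if n: "n \<ge> N" for n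
        proof -
          have "(\<integral>\<^sup>+z. ennreal ((cmod (X m z - X n z))\<^sup>2) \<partial>fock_measure \<alpha>) = ennreal ((fock_norm \<alpha> (X m - X n))\<^sup>2)"
            unfolding fock_norm_sq using D[of m n]
            by (subst nn_integral_eq_integral) (auto simp: fock_space_def)
          also have "\<dots> \<le> ennreal (e\<^sup>2)"
            using N m n by (intro ennreal_leI power_mono) (auto simp: fock_norm_def less_imp_le)
          finally show ?thesis .
        qed
        then have "\<forall>\<^sub>F n in sequentially. (\<integral>\<^sup>+z. ennreal ((cmod (X m z - X n z))\<^sup>2) \<partial>fock_measure \<alpha>) \<le> ennreal (e\<^sup>2)"
          by (auto simp: eventually_sequentially)
        then have "liminf (\<lambda>n. \<integral>\<^sup>+z. ennreal ((cmod (X m z - X n z))\<^sup>2) \<partial>fock_measure \<alpha>) \<le> liminf (\<lambda>n. ennreal (e\<^sup>2))"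
          by (rule Liminf_mono)
        then show ?thesis by (simp add: Liminf_const)
      qed
      finally have le: "(\<integral>\<^sup>+z. ennreal ((cmod (X m z - F z))\<^sup>2) \<partial>fock_measure \<alpha>) \<le> ennreal (e\<^sup>2)" .
      then have int: "integrable (fock_measure \<alpha>) (\<lambda>z. (cmod (X m z - F z))\<^sup>2)"
        by (intro integrableI_bounded) (auto intro: le_less_trans)
      have "(LINT z|fock_measure \<alpha>. (cmod (X m z - F z))\<^sup>2) \<le> e\<^sup>2"
        using le nn_integral_eq_integral[OF int] e by simp
      then have "fock_norm \<alpha> (X m - F) \<le> e"
        unfolding fock_norm_def using e real_sqrt_le_mono by fastforce
      moreover have "X m - F \<in> fock_space \<alpha>"
        using int X_hol F_hol by (auto simp: fock_space_def fun_diff_def intro!: holomorphic_intros)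
      ultimately show ?thesis by blast
    qed
    obtain N1 where "\<forall>m\<ge>N1. \<forall>n\<ge>N1. fock_norm \<alpha> (X m - X n) < 1" using small[of 1] by auto
    then have "X N1 - F \<in> fock_space \<alpha>" using near[of 1 N1 N1] by simp
    then have "F \<in> fock_space \<alpha>" using S.diff_in[OF X[of N1], of "X N1 - F"] by simp
    moreover have "S.tends X F"
      unfolding S.tends_def nrm
    proof (rule LIMSEQ_I)
      fix r :: real assume r: "r > 0"
      obtain N where N: "\<forall>m\<ge>N. \<forall>n\<ge>N. fock_norm \<alpha> (X m - X n) < r / 2"
        using small[of "r / 2"] r by auto
      have "norm (fock_norm \<alpha> (X m - F) - 0) < r" if "m \<ge> N" for m
        using near[OF _ N that] r by (auto simp: fock_norm_def)
      then show "\<exists>N. \<forall>m\<ge>N. norm (fock_norm \<alpha> (X m - F) - 0) < r" by blast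
    qed
    ultimately show "\<exists>l\<in>fock_space \<alpha>. S.tends X l" by blast
  qed
qed

section \<open>Atomic systems of reproducing kernels\<close>

lemma sum_fun_apply: "(\<Sum>i\<in>I. (f i :: 'a \<Rightarrow> 'b::comm_monoid_add)) x = (\<Sum>i\<in>I. f i x)"
  by (induction I rule: infinite_finite_induct) auto

theorem corollary8:
  fixes \<alpha> :: real
    and L :: "(complex \<Rightarrow> complex) \<Rightarrow> (complex \<Rightarrow> complex)"
    and p :: "nat \<Rightarrow> complex"
  assumes "\<alpha> > 0"
    and "fock_bounded_operator \<alpha> L"
    and "inj p"
  shows
    "(fock_atomic_system \<alpha> L (\<lambda>n. fock_normalized_kernel \<alpha> (p n)) \<longleftrightarrow> fock_sampling_sequence \<alpha> L p) \<and>
     (fock_sampling_sequence \<alpha> L p \<longleftrightarrow>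
       fock_bessel \<alpha> (\<lambda>n. fock_normalized_kernel \<alpha> (p n)) \<and>
       (\<exists>g. fock_bessel \<alpha> g \<and>
         (\<forall>f\<in>fock_space \<alpha>.
           fock_sums \<alpha> (\<lambda>n z. fock_inner \<alpha> f (g n) * fock_normalized_kernel \<alpha> (p n) z) (L f)))) \<and>
     (fock_sampling_sequence \<alpha> L p \<longleftrightarrow>
       (\<forall>f\<in>fock_space \<alpha>. summable (\<lambda>n. exp (- \<alpha> * (cmod (p n))\<^sup>2) * (cmod (f (p n)))\<^sup>2)) \<and>
       (\<exists>g. fock_bessel \<alpha> g \<and>
         (\<forall>f\<in>fock_space \<alpha>.
           fock_sums \<alpha> (\<lambda>n z. of_real (exp (- \<alpha> * ((cmod (p n))\<^sup>2 / 2))) * f (p n) * g n z)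
             (fock_adjoint \<alpha> L f))))"
proof -
  interpret H: hilbert_space "\<lambda>c f z. c * f z" "fock_space \<alpha>" "fock_inner \<alpha>"
    using assms(1) by (rule fock_hilbert_space)
  note nrm = fock_norm_eq[of \<alpha>]
  let ?k = "\<lambda>n. fock_normalized_kernel \<alpha> (p n)"
  have k: "?k n \<in> fock_space \<alpha>" for n
    using assms(1) by (rule normalized_kernel_in_fock_space)
  have sums_iff: "fock_sums \<alpha> u s \<longleftrightarrow> H.nrm_sums u s" for u s
  proof -
    have "(\<lambda>z. (\<Sum>n<N. u n z) - s z) = (\<Sum>n<N. u n) - s" for N
      by (simp add: fun_eq_iff sum_fun_apply)
    then show ?thesis
      unfolding fock_sums_def H.nrm_sums_def H.tends_def nrm by simp
  qed
  have bessel_iff: "fock_bessel \<alpha> u \<longleftrightarrow> H.bessel u" for u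
    unfolding fock_bessel_def H.bessel_def nrm ..
  have atomic_iff: "fock_atomic_system \<alpha> L ?k \<longleftrightarrow> H.atomic_system L ?k"
    unfolding fock_atomic_system_def H.atomic_system_def nrm sums_iff ..
  obtain C where C: "\<And>f. f \<in> fock_space \<alpha> \<Longrightarrow> H.nrm (L f) \<le> C * H.nrm f"
    using assms(2) unfolding fock_bounded_operator_def nrm by blast
  have L: "\<And>f. f \<in> fock_space \<alpha> \<Longrightarrow> L f \<in> fock_space \<alpha>"
    "\<And>f g. f \<in> fock_space \<alpha> \<Longrightarrow> g \<in> fock_space \<alpha> \<Longrightarrow> L (f + g) = L f + L g"
    "\<And>c f. f \<in> fock_space \<alpha> \<Longrightarrow> L (\<lambda>z. c * f z) = (\<lambda>z. c * L f z)"
    using assms(2) unfolding fock_bounded_operator_def plus_fun_def by blast+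
  have "fock_adjoint \<alpha> L h \<in> fock_space \<alpha> \<and>
      (\<forall>f\<in>fock_space \<alpha>. fock_inner \<alpha> (L f) h = fock_inner \<alpha> f (fock_adjoint \<alpha> L h))"
    if "h \<in> fock_space \<alpha>" for h
    using theI'[OF H.adjoint_exists[OF L C that]] unfolding fock_adjoint_def .
  then have adj: "H.adjoint_pair L (fock_adjoint \<alpha> L)"
    unfolding H.adjoint_pair_def using L(1) by blast
  have coef: "fock_inner \<alpha> f (?k n) = of_real (exp (- \<alpha> * ((cmod (p n))\<^sup>2 / 2))) * f (p n)"
    if "f \<in> fock_space \<alpha>" for f n
    using assms(1) that by (rule fock_reproducing)
  have coef_sq: "(cmod (fock_inner \<alpha> f (?k n)))\<^sup>2 = exp (- \<alpha> * (cmod (p n))\<^sup>2) * (cmod (f (p n)))\<^sup>2"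
    if "f \<in> fock_space \<alpha>" for f n
  proof -
    have "(exp (- \<alpha> * ((cmod (p n))\<^sup>2 / 2)))\<^sup>2 = exp (- \<alpha> * (cmod (p n))\<^sup>2)"
      by (simp add: exp_double[symmetric])
    then show ?thesis unfolding coef[OF that] norm_mult power_mult_distrib by simp
  qed
  have sampling_iff: "fock_sampling_sequence \<alpha> L p \<longleftrightarrow> H.sampling_for (fock_adjoint \<alpha> L) ?k"
    unfolding fock_sampling_sequence_def H.sampling_for_def nrm
    by (simp add: coef_sq mult.commute cong: ball_cong)
  have summable_iff: "(\<forall>f\<in>fock_space \<alpha>. summable (\<lambda>n. exp (- \<alpha> * (cmod (p n))\<^sup>2) * (cmod (f (p n)))\<^sup>2))
      \<longleftrightarrow> (\<forall>f\<in>fock_space \<alpha>. summable (\<lambda>n. (cmod (fock_inner \<alpha> f (?k n)))\<^sup>2))"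
    by (intro ball_cong refl) (simp only: coef_sq)
  have dual_iff: "(\<forall>f\<in>fock_space \<alpha>. H.nrm_sums (\<lambda>n z. of_real (exp (- \<alpha> * ((cmod (p n))\<^sup>2 / 2))) * f (p n) * g n z)
        (fock_adjoint \<alpha> L f))
      \<longleftrightarrow> (\<forall>f\<in>fock_space \<alpha>. H.nrm_sums (\<lambda>n z. fock_inner \<alpha> f (?k n) * g n z) (fock_adjoint \<alpha> L f))" for g
    by (intro ball_cong refl) (simp only: coef)
  show ?thesis
    unfolding atomic_iff sampling_iff bessel_iff sums_iff summable_iff dual_iff
    using H.atomic_system_characterizations[OF adj, of ?k, OF k] by (intro conjI)
qed

end
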